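(* Let $H(s_1,\dots,s_n)$ be a rational function in $n$ variables given in barycentric (Lagrange) form with respect to nodes $\lambda^{(j)}_{i}\in\mathbb C$ ($1\le i\le n_j$, $1\le j\le n$), barycentric weights $c_{j_1,\dots,j_n}\in\mathbb C$ and values $w_{j_1,\dots,j_n}\in\mathbb C$. Let $0<k<n$ be an integer splitting the variables into column variables $s_1,\dots,s_k$ and row variables $s_{k+1},\dots,s_n$, and let $\Gamma\in\mathbb C^{\kappa\times\kappa}[s_1,\dots,s_k]$, $\Delta\in\mathbb C^{\ell\times\ell}[s_{k+1},\dots,s_n]$, $\mathbb A,\mathbb B\in\mathbb C^{\ell\times\kappa}$ be the matrices defined in the context. Put $m=2\ell+\kappa-1$ and $$\Phi(s_1,\dots,s_n)=\begin{bmatrix}\Gamma(1:\kappa-1,:) & 0_{\kappa-1,\ell-1} & 0_{\kappa-1,\ell}\\ \mathbb A & \Delta(1:\ell-1,:)^\top & 0_{\ell,\ell}\\ \mathbb B & 0_{\ell,\ell-1} & \Delta^\top\end{bmatrix}\in\mathbb C^{m\times m}[s_1,\dots,s_n],$$ $$B=\begin{bmatrix}0_{\kappa-1,1}\\ \Delta(\ell,:)^\top\\ 0_{\ell,1}\end{bmatrix}\in\mathbb C^{m\times1},\qquad C=\begin{bmatrix}0_{1,\kappa} & 0_{1,\ell-1} & -e_\ell^\top\end{bmatrix}\in\mathbb C^{1\times m}.$$ Then $(C,\Phi,B)$ is a realization of $H$ of order $m$, i.e. $$H(s_1,\dots,s_n)=C\,\Phi(s_1,\dots,s_n)^{-1}B$$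 as rational functions.
   Context: Barycentric form: $$H(s_1,\dots,s_n)=\frac{\sum_{j_1=1}^{n_1}\cdots\sum_{j_n=1}^{n_n}\frac{c_{j_1,\dots,j_n}\,w_{j_1,\dots,j_n}}{(s_1-\lambda^{(1)}_{j_1})\cdots(s_n-\lambda^{(n)}_{j_n})}}{\sum_{j_1=1}^{n_1}\cdots\sum_{j_n=1}^{n_n}\frac{c_{j_1,\dots,j_n}}{(s_1-\lambda^{(1)}_{j_1})\cdots(s_n-\lambda^{(n)}_{j_n})}},$$ where for each $j$ the nodes $\lambda^{(j)}_1,\dots,\lambda^{(j)}_{n_j}$ are pairwise distinct and the denominator is not identically zero (so that $H$ is a well-defined rational function). Pseudo-companion Lagrange matrix: with $x^{(j)}_i=s_j-\lambda^{(j)}_i$, set $$\mathbb X^{(j)}=\begin{bmatrix}x^{(j)}_1&-x^{(j)}_2&0&\cdots&0\\ x^{(j)}_1&0&-x^{(j)}_3&\cdots&0\\ \vdots&\vdots&\ddots&\ddots&\vdots\\ x^{(j)}_1&0&\cdots&0&-x^{(j)}_{n_j}\\ q^{(j)}_1&q^{(j)}_2&\cdots&q^{(j)}_{n_j-1}&q^{(j)}_{n_j}\end{bmatrix}\in\mathbb C^{n_j\times n_j}[s_j],$$ where the constants $q^{(j)}_i\in\mathbb C$ are chosen so that $\det\mathbb X^{(j)}=1$ (for instance $1/q^{(j)}_i=\prod_{r\ne i}(\lambda^{(j)}_i-\lambda^{(j)}_r)$). $\Gamma=\mathbb X^{(1)}\otimes\cdots\otimes\mathbb X^{(k)}$ with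 $\kappa=\prod_{j=1}^k n_j$, and $\Delta=\mathbb X^{(k+1)}\otimes\cdots\otimes\mathbb X^{(n)}$ with $\ell=\prod_{j=k+1}^n n_j$ (Kronecker products). Each column index $r\in\{1,\dots,\kappa\}$ of $\Gamma$ corresponds to a multi-index $J_r=(j_1,\dots,j_k)$ and each column index $q\in\{1,\dots,\ell\}$ of $\Delta$ to a multi-index $I_q=(j_{k+1},\dots,j_n)$, in the order imposed by the Kronecker products (lexicographic, last index varying fastest). $\mathbb A$ has $(q,r)$ entry $c_{j_1,\dots,j_n}$ and $\mathbb B$ has $(q,r)$ entry $c_{j_1,\dots,j_n}w_{j_1,\dots,j_n}$, where $(j_1,\dots,j_k)=J_r$ and $(j_{k+1},\dots,j_n)=I_q$. Notation: $M(a:b,:)$ denotes rows $a$ to $b$ of $M$; $M(a,:)$ its $a$-th row; $0_{a,b}$ the $a\times b$ zero matrix; $e_\ell\in\mathbb C^\ell$ the unit vector whose last entry is $1$. Note that the last row of $\Delta$ is constant. *)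

theory Defs
  imports
    "Jordan_Normal_Form.Determinant"
    "HOL-Library.Poly_Mapping"
    "HOL-Computational_Algebra.Polynomial_Factorial"
begin

text \<open>
  Polynomials over the complex numbers in the variables s_0, s_1, s_2, ... (a monomial is a
  finitely supported exponent vector) and their field of fractions. A statement about n variables
  only uses s_1, ..., s_n; equality in the larger field is the same as equality in
  C(s_1, ..., s_n).
\<close>

type_synonym mpoly = "(nat \<Rightarrow>\<^sub>0 nat) \<Rightarrow>\<^sub>0 complex"
type_synonym ratfun = "mpoly fract"

definition const :: "complex \<Rightarrow> mpoly" where
  "const a = Poly_Mapping.single 0 a"

definition svar :: "nat \<Rightarrow> mpoly" where
  "svar j = Poly_Mapping.single (Poly_Mapping.single j 1) 1"

definition polys_in :: "nat set \<Rightarrow> mpoly set" where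
  "polys_in V = {p. \<forall>e \<in> Poly_Mapping.keys p. Poly_Mapping.keys e \<subseteq> V}"

text \<open>
  Node i of variable j is \<open>lam j i\<close>, with \<open>N j\<close> nodes for variable j. Variables, nodes and the
  entries of multi-indices are numbered from 1; rows and columns of matrices and positions in
  lists are numbered from 0. A multi-index is a list. The function \<^const>\<open>product_lists\<close>
  enumerates lexicographically, last index fastest, which is also the order of the
  Kronecker product below.
\<close>

definition multi_indices :: "(nat \<Rightarrow> nat) \<Rightarrow> nat list \<Rightarrow> nat list list" where
  "multi_indices N vs = product_lists (map (\<lambda>j. [1..<Suc (N j)]) vs)"

definition xdiff :: "(nat \<Rightarrow> nat \<Rightarrow> complex) \<Rightarrow> nat \<Rightarrow> nat \<Rightarrow> mpoly" where
  "xdiff lam j i = svar j - const (lam j i)"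

definition barycentric_sum ::
  "nat \<Rightarrow> (nat \<Rightarrow> nat) \<Rightarrow> (nat \<Rightarrow> nat \<Rightarrow> complex) \<Rightarrow> (nat list \<Rightarrow> complex) \<Rightarrow> ratfun" where
  "barycentric_sum n N lam a =
     (\<Sum>js \<in> set (multi_indices N [1..<Suc n]).
        to_fract (const (a js)) / (\<Prod>j = 1..n. to_fract (xdiff lam j (js ! (j - 1)))))"

definition lagrange_mat ::
  "(nat \<Rightarrow> nat) \<Rightarrow> (nat \<Rightarrow> nat \<Rightarrow> complex) \<Rightarrow> (nat \<Rightarrow> nat \<Rightarrow> complex) \<Rightarrow> nat \<Rightarrow> mpoly mat" where
  "lagrange_mat N lam q j = mat (N j) (N j) (\<lambda>(a, b).
     if a = N j - 1 then const (q j (b + 1))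
     else if b = 0 then xdiff lam j 1
     else if b = a + 1 then - xdiff lam j (b + 1)
     else 0)"

definition kron :: "'a :: semiring_1 mat \<Rightarrow> 'a mat \<Rightarrow> 'a mat" where
  "kron A B = mat (dim_row A * dim_row B) (dim_col A * dim_col B) (\<lambda>(a, b).
     A $$ (a div dim_row B, b div dim_col B) * B $$ (a mod dim_row B, b mod dim_col B))"

definition kron_list :: "'a :: semiring_1 mat list \<Rightarrow> 'a mat" where
  "kron_list Ms = foldr kron Ms (1\<^sub>m 1)"

definition coeff_mat ::
  "nat \<Rightarrow> nat \<Rightarrow> (nat \<Rightarrow> nat) \<Rightarrow> (nat list \<Rightarrow> complex) \<Rightarrow> complex mat" where
  "coeff_mat n k N a =
     mat (\<Prod>j = k+1..n. N j) (\<Prod>j = 1..k. N j) (\<lambda>(q, r).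
       a (multi_indices N [1..<Suc k] ! r @ multi_indices N [Suc k..<Suc n] ! q))"

text \<open>\<open>rows_of M a b\<close> is M(a:b,:), with rows counted from 1; it has no rows if b = a - 1.\<close>

definition rows_of :: "'a mat \<Rightarrow> nat \<Rightarrow> nat \<Rightarrow> 'a mat" where
  "rows_of M a b = mat (b + 1 - a) (dim_col M) (\<lambda>(i, j). M $$ (a - 1 + i, j))"

definition append_cols :: "'a :: zero mat \<Rightarrow> 'a mat \<Rightarrow> 'a mat" (infixr "@\<^sub>c" 70) where
  "A @\<^sub>c B = four_block_mat A B (0\<^sub>m 0 (dim_col A)) (0\<^sub>m 0 (dim_col B))"

text \<open>
  H = C Phi^(-1) B over the field of rational functions, with Phi an m x m matrix with entries in
  C[s_1, ..., s_n] that is invertible over that field, and B, C matrices of constants.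
\<close>

definition is_realization ::
  "nat \<Rightarrow> nat \<Rightarrow> mpoly mat \<Rightarrow> mpoly mat \<Rightarrow> mpoly mat \<Rightarrow> ratfun \<Rightarrow> bool" where
  "is_realization n m C \<Phi> B H \<longleftrightarrow>
     C \<in> map_mat const ` carrier_mat 1 m \<and>
     \<Phi> \<in> carrier_mat m m \<and> elements_mat \<Phi> \<subseteq> polys_in {1..n} \<and>
     B \<in> map_mat const ` carrier_mat m 1 \<and>
     (\<exists>\<Psi> \<in> carrier_mat m m.
        inverts_mat (map_mat to_fract \<Phi>) \<Psi> \<and> inverts_mat \<Psi> (map_mat to_fract \<Phi>) \<and>
        mat 1 1 (\<lambda>_. H) = map_mat to_fract C * \<Psi> * map_mat to_fract B)"

end

(* Let y^(j) be the column with entries 1 / x^(j)_i. The first n_j - 1 rows of X^(j) annihilate it,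
   and X^(j) is invertible, so X^(j) y^(j) is a nonzero multiple of the last unit vector. By the
   mixed-product property, the Kronecker products v of y^(1), ..., y^(k) and u of
   y^(k+1), ..., y^(n) satisfy Gamma v = g e_kappa and Delta u = d e_l with g, d nonzero, while
   u^T AA v and u^T BB v are the denominator and the numerator of H.
   Suppose Phi (z1, z2, z3) = B. The first block row forces z1 = alpha v. Pairing the other two
   with u removes z2 and leaves alpha u^T AA v = d and alpha u^T BB v + d (z3)_l = 0, so
   -(z3)_l = H. The same steps with right-hand side zero show that Phi has trivial kernel. *)
theory Submission
  imports Defs
begin

section \<open>Block matrices\<close>

text \<open>The identity is linear algebra over any field. About Gamma and Delta it uses only that
  they are invertible and send v and u to nonzero multiples of the last unit vector. The factors g
  and d are never evaluated: alpha = d / (u^T AA v), so d cancels in H, and g only has to be nonzero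
  for v to span the kernel of Gamma(1:kappa-1,:). Hence \<open>block_realization\<close> treats
  arbitrary matrices. That the denominator of H does not vanish says exactly that u^T AA v is
  nonzero, which forces alpha = 0 in the homogeneous system; z2 and z3 then vanish because the rows
  of Delta are independent. The rest is index bookkeeping: positions in lists of multi-indices and
  in Kronecker products both split by quotient and remainder, which matches AA and BB with u and v.
  If kappa = 1 or l = 1 some blocks are empty, so positivity of both sizes is carried along. A
  realization also needs polynomial entries in Phi and constant entries in B; these are traced
  through Kronecker products by means of sets closed under multiplication.\<close>

lemma append_cols_carrier [simp, intro]:
  "A \<in> carrier_mat r c1 \<Longrightarrow> B \<in> carrier_mat r c2 \<Longrightarrow> A @\<^sub>c B \<in> carrier_mat r (c1 + c2)"
  unfolding append_cols_def by auto

lemma append_cols_mult_vec: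
  fixes A :: "'a :: semiring_0 mat"
  assumes A: "A \<in> carrier_mat r c1" and B: "B \<in> carrier_mat r c2"
    and a: "a \<in> carrier_vec c1" and b: "b \<in> carrier_vec c2"
  shows "(A @\<^sub>c B) *\<^sub>v (a @\<^sub>v b) = A *\<^sub>v a + B *\<^sub>v b"
proof -
  \<comment> \<open>The two lower blocks have no rows, so the block product formula contributes a
    vector of length 0 there.\<close>
  have "(A @\<^sub>c B) *\<^sub>v (a @\<^sub>v b) = (A *\<^sub>v a + B *\<^sub>v b) @\<^sub>v (0\<^sub>m 0 c1 *\<^sub>v a + 0\<^sub>m 0 c2 *\<^sub>v b)"
    unfolding append_cols_def using A B
    by (auto intro!: four_block_mat_mult_vec[OF A B _ _ a b])
  also have "\<dots> = A *\<^sub>v a + B *\<^sub>v b"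
    by (intro eq_vecI) auto
  finally show ?thesis .
qed

lemma map_append_cols:
  assumes "A \<in> carrier_mat r c1" "B \<in> carrier_mat r c2"
  shows "map_mat f (A @\<^sub>c B) = map_mat f A @\<^sub>c map_mat f B"
  unfolding append_cols_def using assms by (intro eq_matI) auto

lemma map_append_rows:
  assumes "A \<in> carrier_mat r1 c" "B \<in> carrier_mat r2 c"
  shows "map_mat f (A @\<^sub>r B) = map_mat f A @\<^sub>r map_mat f B"
  unfolding append_rows_def using assms by (intro eq_matI) auto

lemma elements_append_cols:
  assumes "A \<in> carrier_mat r c1" "B \<in> carrier_mat r c2"
  shows "elements_mat (A @\<^sub>c B) \<subseteq> elements_mat A \<union> elements_mat B"
proof -
  have [simp]: "elements_mat (0\<^sub>m 0 c) = {}" for c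
    by (auto simp: elements_mat_def)
  show ?thesis
    using elements_four_block_mat[OF assms, of "0\<^sub>m 0 c1" 0 "0\<^sub>m 0 c2"] assms
    unfolding append_cols_def by auto
qed

lemma elements_append_rows:
  assumes "A \<in> carrier_mat r1 c" "B \<in> carrier_mat r2 c"
  shows "elements_mat (A @\<^sub>r B) \<subseteq> elements_mat A \<union> elements_mat B"
proof -
  have [simp]: "elements_mat (0\<^sub>m r 0) = {}" for r
    by (auto simp: elements_mat_def)
  show ?thesis
    using elements_four_block_mat[OF assms(1) _ assms(2), of "0\<^sub>m r1 0" 0 "0\<^sub>m r2 0"] assms
    unfolding append_rows_def by auto
qed

lemma rows_of_initial_carrier [simp, intro]:
  "M \<in> carrier_mat r c \<Longrightarrow> rows_of M (Suc 0) b \<in> carrier_mat b c"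
  unfolding rows_of_def by auto

lemma rows_of_single_carrier [simp, intro]:
  "M \<in> carrier_mat r c \<Longrightarrow> rows_of M b b \<in> carrier_mat (Suc 0) c"
  unfolding rows_of_def by auto

lemma map_rows_of:
  assumes "M \<in> carrier_mat r c" "1 \<le> a" "b \<le> r"
  shows "map_mat f (rows_of M a b) = rows_of (map_mat f M) a b"
  unfolding rows_of_def using assms by (intro eq_matI) auto

lemma elements_rows_of:
  assumes "M \<in> carrier_mat r c" "1 \<le> a" "b \<le> r"
  shows "elements_mat (rows_of M a b) \<subseteq> elements_mat M"
proof
  fix x assume "x \<in> elements_mat (rows_of M a b)"
  then obtain i j where "i < b + 1 - a" "j < c" "x = M $$ (a - 1 + i, j)"
    using assms by (auto simp: rows_of_def dest!: elements_matD)
  then show "x \<in> elements_mat M"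
    using assms by (intro elements_matI[of _ r c "a - 1 + i" j]) auto
qed

lemma elements_transpose [simp]: "elements_mat A\<^sup>T = elements_mat A"
  unfolding elements_mat_def by auto

lemma row_rows_of:
  assumes "M \<in> carrier_mat r c" "1 \<le> a" "b \<le> r" "i < b + 1 - a"
  shows "row (rows_of M a b) i = row M (a - 1 + i)"
  using assms by (intro eq_vecI) (auto simp: rows_of_def)

lemma rows_of_mult_vec:
  assumes "M \<in> carrier_mat r c" "1 \<le> a" "b \<le> r"
  shows "rows_of M a b *\<^sub>v v = vec (b + 1 - a) (\<lambda>i. (M *\<^sub>v v) $ (a - 1 + i))"
  using assms row_rows_of[OF assms]
  by (intro eq_vecI) (auto simp: rows_of_def)

section \<open>The block matrix over a field\<close>

lemma mat_mult_vec_inj: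
  fixes A :: "'a :: field mat"
  assumes "A \<in> carrier_mat n n" "det A \<noteq> 0" "v \<in> carrier_vec n" "A *\<^sub>v v = 0\<^sub>v n"
  shows "v = 0\<^sub>v n"
  using det_0_iff_vec_prod_zero_field[OF assms(1)] assms by blast

lemma invertible_from_det:
  fixes A :: "'a :: field mat"
  assumes A: "A \<in> carrier_mat n n" and "det A \<noteq> 0"
  obtains Y where "Y \<in> carrier_mat n n" "A * Y = 1\<^sub>m n" "Y * A = 1\<^sub>m n"
  \<comment> \<open>A unit of the matrix ring has a two-sided inverse; \<open>()\<close> fills the
    extension slot of the ring record.\<close>
  using det_non_zero_imp_unit[OF assms, of "()"] unfolding Units_def ring_mat_def by auto

text \<open>Only the last coordinate of G z is left free, so G z is a multiple of G v; injectivity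
  of G carries the factor, the quotient b / g of the last coordinates, back to z and v.\<close>

lemma kernel_rows_of:
  fixes G :: "'a :: field mat"
  assumes G: "G \<in> carrier_mat n n" "det G \<noteq> 0" and n: "0 < n"
    and v: "v \<in> carrier_vec n" "G *\<^sub>v v = g \<cdot>\<^sub>v unit_vec n (n - 1)" "g \<noteq> 0"
    and z: "z \<in> carrier_vec n" "rows_of G 1 (n - 1) *\<^sub>v z = 0\<^sub>v (n - 1)"
  shows "\<exists>\<alpha>. z = \<alpha> \<cdot>\<^sub>v v"
proof -
  define b where "b = (G *\<^sub>v z) $ (n - 1)"
  have 0: "(G *\<^sub>v z) $ i = 0" if "i < n - 1" for i
    using arg_cong[OF z(2), of "\<lambda>w. w $ i"] that n
    by (simp add: rows_of_mult_vec[OF G(1)])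
  have Gz: "G *\<^sub>v z = b \<cdot>\<^sub>v unit_vec n (n - 1)"
  proof (rule eq_vecI)
    fix i assume "i < dim_vec (b \<cdot>\<^sub>v unit_vec n (n - 1))"
    then show "(G *\<^sub>v z) $ i = (b \<cdot>\<^sub>v unit_vec n (n - 1)) $ i"
      using 0[of i] n by (cases "i = n - 1") (auto simp: b_def unit_vec_def)
  qed (use G in auto)
  have gb: "b / g * g = b" using v by simp
  have "G *\<^sub>v (z - (b / g) \<cdot>\<^sub>v v) = G *\<^sub>v z - (b / g) \<cdot>\<^sub>v (G *\<^sub>v v)"
    using G v z by (simp add: mult_minus_distrib_mat_vec[of _ n n] mult_mat_vec[of _ n n])
  also have "\<dots> = 0\<^sub>v n"
    unfolding Gz v(2) smult_smult_assoc gb by auto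
  finally have *: "z - (b / g) \<cdot>\<^sub>v v = 0\<^sub>v n"
    using mat_mult_vec_inj[OF G] v z by auto
  have "z $ i = ((b / g) \<cdot>\<^sub>v v) $ i" if "i < n" for i
    using arg_cong[OF *, of "\<lambda>w. w $ i"] that v(1) z(1) by simp
  then have "z = (b / g) \<cdot>\<^sub>v v"
    using v z by (intro eq_vecI) auto
  then show ?thesis ..
qed

text \<open>All rows of D except the last are orthogonal to u, and these rows span the image of the
  transposed block. This is what removes z2 from the second block row.\<close>

lemma scalar_prod_transpose_rows_of:
  fixes D :: "'a :: field mat"
  assumes D: "D \<in> carrier_mat n n" and n: "0 < n"
    and u: "u \<in> carrier_vec n" "D *\<^sub>v u = d \<cdot>\<^sub>v unit_vec n (n - 1)"
    and z: "z \<in> carrier_vec (n - 1)"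
  shows "u \<bullet> ((rows_of D 1 (n - 1))\<^sup>T *\<^sub>v z) = 0"
proof -
  have R: "rows_of D 1 (n - 1) \<in> carrier_mat (n - 1) n"
    using D by auto
  have "rows_of D 1 (n - 1) *\<^sub>v u = 0\<^sub>v (n - 1)"
    using n by (subst rows_of_mult_vec[OF D]) (auto simp: u(2) unit_vec_def)
  then have "((rows_of D 1 (n - 1))\<^sup>T *\<^sub>v z) \<bullet> u = 0"
    using transpose_vec_mult_scalar[OF R u(1) z] z by simp
  then show ?thesis
    using comm_scalar_prod[OF u(1), of "(rows_of D 1 (n - 1))\<^sup>T *\<^sub>v z"] R z
    by (metis mult_mat_vec_carrier transpose_carrier_mat)
qed

text \<open>Padding z with a final zero turns the truncated transpose into the full one, which is
  injective because its determinant is that of D.\<close>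

lemma transpose_rows_of_inj:
  fixes D :: "'a :: field mat"
  assumes D: "D \<in> carrier_mat n n" "det D \<noteq> 0" and n: "0 < n"
    and z: "z \<in> carrier_vec (n - 1)" "(rows_of D 1 (n - 1))\<^sup>T *\<^sub>v z = 0\<^sub>v n"
  shows "z = 0\<^sub>v (n - 1)"
proof -
  have *: "z @\<^sub>v 0\<^sub>v 1 \<in> carrier_vec n"
    using append_carrier_vec[OF z(1), of "0\<^sub>v 1" 1] n by simp
  have "D\<^sup>T *\<^sub>v (z @\<^sub>v 0\<^sub>v 1) = (rows_of D 1 (n - 1))\<^sup>T *\<^sub>v z"
  proof (rule eq_vecI)
    fix i assume "i < dim_vec ((rows_of D 1 (n - 1))\<^sup>T *\<^sub>v z)"
    then have i: "i < n" using D by (auto simp: rows_of_def)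
    \<comment> \<open>The last entry of the column is split off because it meets the padding zero;
      what remains is a column of the truncated matrix.\<close>
    have "col D i = vec (n - 1) (\<lambda>a. D $$ (a, i)) @\<^sub>v vec 1 (\<lambda>_. D $$ (n - 1, i))"
    proof (rule eq_vecI)
      fix a assume "a < dim_vec (vec (n - 1) (\<lambda>a. D $$ (a, i)) @\<^sub>v vec 1 (\<lambda>_. D $$ (n - 1, i)))"
      then have "a < n" using n by simp
      then show "col D i $ a = (vec (n - 1) (\<lambda>a. D $$ (a, i)) @\<^sub>v vec 1 (\<lambda>_. D $$ (n - 1, i))) $ a"
        using D i by (cases "a = n - 1") auto
    qed (use D n in auto)
    moreover have "(vec (n - 1) (\<lambda>a. D $$ (a, i)) @\<^sub>v vec 1 (\<lambda>_. D $$ (n - 1, i))) \<bullet> (z @\<^sub>v 0\<^sub>v 1)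
        = vec (n - 1) (\<lambda>a. D $$ (a, i)) \<bullet> z + vec 1 (\<lambda>_. D $$ (n - 1, i)) \<bullet> 0\<^sub>v 1"
      using z by (intro scalar_prod_append[of _ "n - 1" _ 1]) auto
    moreover have "col (rows_of D 1 (n - 1)) i = vec (n - 1) (\<lambda>a. D $$ (a, i))"
      using D i by (intro eq_vecI) (auto simp: rows_of_def)
    ultimately show "(D\<^sup>T *\<^sub>v (z @\<^sub>v 0\<^sub>v 1)) $ i = ((rows_of D 1 (n - 1))\<^sup>T *\<^sub>v z) $ i"
      using D i by (auto simp: rows_of_def)
  qed (use D in \<open>auto simp: rows_of_def\<close>)
  then have "z @\<^sub>v 0\<^sub>v 1 = 0\<^sub>v n"
    using D z(2) det_transpose[OF D(1)] mat_mult_vec_inj[OF _ _ *, of "D\<^sup>T"] by simp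
  also have "0\<^sub>v n = 0\<^sub>v (n - 1) @\<^sub>v (0\<^sub>v 1 :: 'a vec)"
    using n by (intro eq_vecI) auto
  finally show ?thesis
    using append_vec_eq[OF z(1), of "0\<^sub>v (n - 1)" "0\<^sub>v 1" "0\<^sub>v 1"] by simp
qed

text \<open>Here A and E stand for the coefficient matrices of the denominator and the numerator.
  Polynomials enter only when this is applied over the fraction field.\<close>

lemma block_realization:
  fixes G D A E :: "'a :: field mat"
  assumes G: "G \<in> carrier_mat \<kappa> \<kappa>" "det G \<noteq> 0" and \<kappa>: "0 < \<kappa>"
    and D: "D \<in> carrier_mat l l" "det D \<noteq> 0" and l: "0 < l"
    and A: "A \<in> carrier_mat l \<kappa>" and E: "E \<in> carrier_mat l \<kappa>"
    and v: "v \<in> carrier_vec \<kappa>" "G *\<^sub>v v = g \<cdot>\<^sub>v unit_vec \<kappa> (\<kappa> - 1)" "g \<noteq> 0"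
    and u: "u \<in> carrier_vec l" "D *\<^sub>v u = d \<cdot>\<^sub>v unit_vec l (l - 1)" "d \<noteq> 0"
    and uAv: "u \<bullet> (A *\<^sub>v v) \<noteq> 0"
    and m: "m = 2 * l + \<kappa> - 1"
    and \<Phi>: "\<Phi> =
        (rows_of G 1 (\<kappa> - 1) @\<^sub>c 0\<^sub>m (\<kappa> - 1) (l - 1) @\<^sub>c 0\<^sub>m (\<kappa> - 1) l)
        @\<^sub>r (A @\<^sub>c (rows_of D 1 (l - 1))\<^sup>T @\<^sub>c 0\<^sub>m l l)
        @\<^sub>r (E @\<^sub>c 0\<^sub>m l (l - 1) @\<^sub>c D\<^sup>T)"
    and B: "B = 0\<^sub>m (\<kappa> - 1) 1 @\<^sub>r (rows_of D l l)\<^sup>T @\<^sub>r 0\<^sub>m l 1"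
    and C: "C = 0\<^sub>m 1 \<kappa> @\<^sub>c 0\<^sub>m 1 (l - 1) @\<^sub>c (- mat_of_row (unit_vec l (l - 1)))"
  shows "\<exists>\<Psi> \<in> carrier_mat m m. inverts_mat \<Phi> \<Psi> \<and> inverts_mat \<Psi> \<Phi> \<and>
    mat 1 1 (\<lambda>_. u \<bullet> (E *\<^sub>v v) / (u \<bullet> (A *\<^sub>v v))) = C * \<Psi> * B"
proof -
  let ?R = "rows_of G 1 (\<kappa> - 1)" and ?P = "(rows_of D 1 (l - 1))\<^sup>T"
  have R: "?R \<in> carrier_mat (\<kappa> - 1) \<kappa>" and P: "?P \<in> carrier_mat l (l - 1)"
    using G D by auto
  have DT: "D\<^sup>T \<in> carrier_mat l l" "det D\<^sup>T \<noteq> 0"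
    using D det_transpose[OF D(1)] by auto
  \<comment> \<open>The missing unit of m sits in the middle block of columns but in the first block
    of rows. Subtraction is truncated, so both sizes must be positive.\<close>
  have cols: "\<kappa> + (l - 1 + l) = m" and rows: "\<kappa> - 1 + (l + l) = m"
    using m l \<kappa> by auto
  have r1: "?R @\<^sub>c 0\<^sub>m (\<kappa> - 1) (l - 1) @\<^sub>c 0\<^sub>m (\<kappa> - 1) l \<in> carrier_mat (\<kappa> - 1) m"
    and r2: "A @\<^sub>c ?P @\<^sub>c 0\<^sub>m l l \<in> carrier_mat l m"
    and r3: "E @\<^sub>c 0\<^sub>m l (l - 1) @\<^sub>c D\<^sup>T \<in> carrier_mat l m"
    unfolding cols[symmetric] using A E DT
    by (intro append_cols_carrier R P; simp)+
  have Phi: "\<Phi> \<in> carrier_mat m m"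
    using carrier_append_rows[OF r1 carrier_append_rows[OF r2 r3]] unfolding \<Phi> rows .
  have Phi_mult: "\<Phi> *\<^sub>v (z1 @\<^sub>v z2 @\<^sub>v z3) =
      (?R *\<^sub>v z1) @\<^sub>v (A *\<^sub>v z1 + ?P *\<^sub>v z2) @\<^sub>v (E *\<^sub>v z1 + D\<^sup>T *\<^sub>v z3)"
    if z: "z1 \<in> carrier_vec \<kappa>" "z2 \<in> carrier_vec (l - 1)" "z3 \<in> carrier_vec l" for z1 z2 z3
  proof -
    have zc: "z1 @\<^sub>v z2 @\<^sub>v z3 \<in> carrier_vec m"
      unfolding cols[symmetric] using z by (intro append_carrier_vec)
    have zero_mult: "0\<^sub>m a b *\<^sub>v x = 0\<^sub>v a" if "x \<in> carrier_vec b" for a b and x :: "'a vec"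
      using that by (intro eq_vecI) auto
    note mult = append_cols_mult_vec[OF _ append_cols_carrier z(1) append_carrier_vec[OF z(2,3)]]
      append_cols_mult_vec[OF _ _ z(2,3)]
    have "(?R @\<^sub>c 0\<^sub>m (\<kappa> - 1) (l - 1) @\<^sub>c 0\<^sub>m (\<kappa> - 1) l) *\<^sub>v (z1 @\<^sub>v z2 @\<^sub>v z3) = ?R *\<^sub>v z1"
      using z R mult_mat_vec_carrier[OF R z(1)]
      by (simp add: mult[of _ "\<kappa> - 1"] zero_mult del: One_nat_def)
    moreover have "(A @\<^sub>c ?P @\<^sub>c 0\<^sub>m l l) *\<^sub>v (z1 @\<^sub>v z2 @\<^sub>v z3) = A *\<^sub>v z1 + ?P *\<^sub>v z2"
      using z A P mult_mat_vec_carrier[OF P z(2)]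
      by (simp add: mult[of _ l] zero_mult del: One_nat_def)
    moreover have "(E @\<^sub>c 0\<^sub>m l (l - 1) @\<^sub>c D\<^sup>T) *\<^sub>v (z1 @\<^sub>v z2 @\<^sub>v z3) = E *\<^sub>v z1 + D\<^sup>T *\<^sub>v z3"
      using z E DT mult_mat_vec_carrier[OF DT(1) z(3)]
      by (simp add: mult[of _ l] zero_mult del: One_nat_def)
    ultimately show ?thesis
      unfolding \<Phi> mat_mult_append[OF r1 carrier_append_rows[OF r2 r3] zc]
        mat_mult_append[OF r2 r3 zc] by simp
  qed
  have split: "\<exists>z1 z2 z3. z = z1 @\<^sub>v z2 @\<^sub>v z3 \<and>
      z1 \<in> carrier_vec \<kappa> \<and> z2 \<in> carrier_vec (l - 1) \<and> z3 \<in> carrier_vec l"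
    if "z \<in> carrier_vec m" for z :: "'a vec"
    using that unfolding cols[symmetric]
    by (metis vec_first_last_append vec_first_carrier vec_last_carrier)
  have zero_split: "0\<^sub>v m = 0\<^sub>v (\<kappa> - 1) @\<^sub>v 0\<^sub>v l @\<^sub>v (0\<^sub>v l :: 'a vec)"
    unfolding rows[symmetric] by (intro eq_vecI) auto
  \<comment> \<open>This serves both the homogeneous system and the one with right-hand side
    B.\<close>
  have pairing: "u \<bullet> (A *\<^sub>v (\<alpha> \<cdot>\<^sub>v v) + ?P *\<^sub>v z2) = \<alpha> * (u \<bullet> (A *\<^sub>v v))"
    if "z2 \<in> carrier_vec (l - 1)" for \<alpha> z2
    using scalar_prod_transpose_rows_of[OF D(1) l u(1,2) that] u v A P that
    by (subst scalar_prod_add_distrib[of _ l]) (auto simp: mult_mat_vec[of _ l \<kappa>])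
  have "det \<Phi> \<noteq> 0"
  proof
    assume "det \<Phi> = 0"
    then obtain z where z: "z \<in> carrier_vec m" "z \<noteq> 0\<^sub>v m" "\<Phi> *\<^sub>v z = 0\<^sub>v m"
      using det_0_iff_vec_prod_zero_field[OF Phi] by auto
    obtain z1 z2 z3 where zz: "z = z1 @\<^sub>v z2 @\<^sub>v z3"
      and c: "z1 \<in> carrier_vec \<kappa>" "z2 \<in> carrier_vec (l - 1)" "z3 \<in> carrier_vec l"
      using split[OF z(1)] by auto
    have eqs: "?R *\<^sub>v z1 = 0\<^sub>v (\<kappa> - 1)" "A *\<^sub>v z1 + ?P *\<^sub>v z2 = 0\<^sub>v l" "E *\<^sub>v z1 + D\<^sup>T *\<^sub>v z3 = 0\<^sub>v l"
    proof -
      have *: "?R *\<^sub>v z1 \<in> carrier_vec (\<kappa> - 1)" "A *\<^sub>v z1 + ?P *\<^sub>v z2 \<in> carrier_vec l"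
        using R A P c by auto
      have "(?R *\<^sub>v z1) @\<^sub>v (A *\<^sub>v z1 + ?P *\<^sub>v z2) @\<^sub>v (E *\<^sub>v z1 + D\<^sup>T *\<^sub>v z3)
          = 0\<^sub>v (\<kappa> - 1) @\<^sub>v 0\<^sub>v l @\<^sub>v 0\<^sub>v l"
        using z(3) unfolding zz Phi_mult[OF c] zero_split .
      then show "?R *\<^sub>v z1 = 0\<^sub>v (\<kappa> - 1)" "A *\<^sub>v z1 + ?P *\<^sub>v z2 = 0\<^sub>v l" "E *\<^sub>v z1 + D\<^sup>T *\<^sub>v z3 = 0\<^sub>v l"
        unfolding append_vec_eq[OF *(1) zero_carrier_vec] append_vec_eq[OF *(2) zero_carrier_vec]
        by auto
    qed
    obtain \<alpha> where \<alpha>: "z1 = \<alpha> \<cdot>\<^sub>v v"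
      using kernel_rows_of[OF G \<kappa> v c(1) eqs(1)] by auto
    \<comment> \<open>Nonvanishing of the denominator enters here and forces alpha = 0. The two
      remaining block rows then decouple.\<close>
    have "\<alpha> * (u \<bullet> (A *\<^sub>v v)) = 0"
      using pairing[OF c(2), of \<alpha>] eqs(2) u(1) unfolding \<alpha> by simp
    then have z1: "z1 = 0\<^sub>v \<kappa>"
      using uAv \<alpha> v(1) by auto
    then have Az: "A *\<^sub>v z1 = 0\<^sub>v l" "E *\<^sub>v z1 = 0\<^sub>v l"
      using A E by (auto intro!: eq_vecI)
    have "?P *\<^sub>v z2 = 0\<^sub>v l" "D\<^sup>T *\<^sub>v z3 = 0\<^sub>v l"
      using eqs(2,3) mult_mat_vec_carrier[OF P c(2)] mult_mat_vec_carrier[OF DT(1) c(3)]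
      unfolding Az by simp_all
    then have "z2 = 0\<^sub>v (l - 1)" "z3 = 0\<^sub>v l"
      using transpose_rows_of_inj[OF D l c(2)] mat_mult_vec_inj[OF DT c(3)] by auto
    then have "z = 0\<^sub>v m"
      unfolding zz z1 cols[symmetric] by (auto intro!: eq_vecI)
    then show False using z(2) by simp
  qed
  then obtain Y where Y: "Y \<in> carrier_mat m m" "\<Phi> * Y = 1\<^sub>m m" "Y * \<Phi> = 1\<^sub>m m"
    using invertible_from_det[OF Phi] by blast
  have Bc: "B \<in> carrier_mat m 1"
    unfolding B rows[symmetric]
    using D by (intro carrier_append_rows) auto
  have "col B 0 = 0\<^sub>v (\<kappa> - 1) @\<^sub>v row D (l - 1) @\<^sub>v 0\<^sub>v l"
    unfolding B append_rows_def using D l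
    by (intro eq_vecI) (auto simp: rows_of_def)
  \<comment> \<open>The inverse is never computed: z is the solution of Phi z = B, and only its last
    coordinate matters for C z.\<close>
  define z where "z = col (Y * B) 0"
  have z: "z \<in> carrier_vec m" and Phi_z: "\<Phi> *\<^sub>v z = col B 0"
  proof -
    show "z \<in> carrier_vec m" unfolding z_def using Y Bc by auto
    have "\<Phi> *\<^sub>v z = col (\<Phi> * (Y * B)) 0"
      unfolding z_def using Y Bc Phi by (subst col_mult2[of _ m m _ 1]) auto
    also have "\<Phi> * (Y * B) = B"
      using Y Bc Phi by (subst assoc_mult_mat[symmetric, of _ m m _ m _ 1]) auto
    finally show "\<Phi> *\<^sub>v z = col B 0" .
  qed
  obtain z1 z2 z3 where zz: "z = z1 @\<^sub>v z2 @\<^sub>v z3"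
    and c: "z1 \<in> carrier_vec \<kappa>" "z2 \<in> carrier_vec (l - 1)" "z3 \<in> carrier_vec l"
    using split[OF z] by auto
  have eqs: "?R *\<^sub>v z1 = 0\<^sub>v (\<kappa> - 1)" "A *\<^sub>v z1 + ?P *\<^sub>v z2 = row D (l - 1)" "E *\<^sub>v z1 + D\<^sup>T *\<^sub>v z3 = 0\<^sub>v l"
  proof -
    have *: "?R *\<^sub>v z1 \<in> carrier_vec (\<kappa> - 1)" "A *\<^sub>v z1 + ?P *\<^sub>v z2 \<in> carrier_vec l" "row D (l - 1) \<in> carrier_vec l"
      using D l mult_mat_vec_carrier[OF R c(1)]
        add_carrier_vec[OF mult_mat_vec_carrier[OF A c(1)] mult_mat_vec_carrier[OF P c(2)]]
      by auto
    have "(?R *\<^sub>v z1) @\<^sub>v (A *\<^sub>v z1 + ?P *\<^sub>v z2) @\<^sub>v (E *\<^sub>v z1 + D\<^sup>T *\<^sub>v z3)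
        = 0\<^sub>v (\<kappa> - 1) @\<^sub>v row D (l - 1) @\<^sub>v 0\<^sub>v l"
      using Phi_z \<open>col B 0 = _\<close> unfolding zz Phi_mult[OF c] by simp
    then show "?R *\<^sub>v z1 = 0\<^sub>v (\<kappa> - 1)" "A *\<^sub>v z1 + ?P *\<^sub>v z2 = row D (l - 1)" "E *\<^sub>v z1 + D\<^sup>T *\<^sub>v z3 = 0\<^sub>v l"
      unfolding append_vec_eq[OF *(1) zero_carrier_vec] append_vec_eq[OF *(2,3)]
      by auto
  qed
  obtain \<alpha> where \<alpha>: "z1 = \<alpha> \<cdot>\<^sub>v v"
    using kernel_rows_of[OF G \<kappa> v c(1) eqs(1)] by auto
  \<comment> \<open>The right-hand side was chosen so that its pairing with u is the last coordinate
    of D u, which is d.\<close>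
  have "row D (l - 1) \<in> carrier_vec l" using D(1) l by auto
  then have "u \<bullet> row D (l - 1) = row D (l - 1) \<bullet> u"
    by (rule comm_scalar_prod[OF u(1)])
  also have "\<dots> = (D *\<^sub>v u) $ (l - 1)"
    using D(1) l by simp
  also have "\<dots> = d" using l by (simp add: u(2))
  finally have ad: "\<alpha> * (u \<bullet> (A *\<^sub>v v)) = d"
    using pairing[OF c(2), of \<alpha>] eqs(2) unfolding \<alpha> by simp
  \<comment> \<open>Moving the transpose onto u leaves a multiple of the last unit vector, which
    reads off the last coordinate of z3.\<close>
  have "u \<bullet> (D\<^sup>T *\<^sub>v z3) = d * z3 $ (l - 1)"
  proof -
    have "u \<bullet> (D\<^sup>T *\<^sub>v z3) = (D\<^sup>T *\<^sub>v z3) \<bullet> u"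
      using u c DT by (intro comm_scalar_prod[of _ l]) auto
    also have "\<dots> = z3 \<bullet> (D *\<^sub>v u)"
      using transpose_vec_mult_scalar[OF D(1) u(1) c(3)] .
    also have "\<dots> = d * z3 $ (l - 1)"
      using c l unfolding u(2) by simp
    finally show ?thesis .
  qed
  moreover have "u \<bullet> (E *\<^sub>v z1 + D\<^sup>T *\<^sub>v z3) = \<alpha> * (u \<bullet> (E *\<^sub>v v)) + u \<bullet> (D\<^sup>T *\<^sub>v z3)"
    unfolding \<alpha> using u v E DT c
    by (subst scalar_prod_add_distrib[of _ l]) (auto simp: mult_mat_vec[of _ l \<kappa>])
  ultimately have "\<alpha> * (u \<bullet> (E *\<^sub>v v)) + d * z3 $ (l - 1) = 0"
    using eqs(3) u(1) by simp
  then have "d * (- z3 $ (l - 1)) = \<alpha> * (u \<bullet> (E *\<^sub>v v))"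
    by (metis minus_unique minus_minus mult_minus_right)
  \<comment> \<open>Replacing d by alpha times the denominator exposes alpha on both sides; it
    cancels because d, hence alpha, is nonzero.\<close>
  then have "\<alpha> * ((u \<bullet> (A *\<^sub>v v)) * (- z3 $ (l - 1))) = \<alpha> * (u \<bullet> (E *\<^sub>v v))"
    using ad by (metis mult.assoc)
  moreover have "\<alpha> \<noteq> 0" using ad u(3) by auto
  ultimately have z3: "- z3 $ (l - 1) = u \<bullet> (E *\<^sub>v v) / (u \<bullet> (A *\<^sub>v v))"
    using uAv by (metis mult_left_cancel nonzero_mult_div_cancel_left)
  have Cc: "C \<in> carrier_mat 1 m"
    unfolding C cols[symmetric] by (intro append_cols_carrier) auto
  have "C * Y * B = C * (Y * B)"
    using Cc Y Bc by (intro assoc_mult_mat[of _ 1 m _ m _ 1]) auto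
  moreover have "(C * (Y * B)) $$ (0, 0) = (C *\<^sub>v z) $ 0"
    unfolding z_def using Cc Y Bc by simp
  moreover have "C *\<^sub>v z = - mat_of_row (unit_vec l (l - 1)) *\<^sub>v z3"
    unfolding C zz
    by (subst append_cols_mult_vec[OF _ _ c(1) append_carrier_vec[OF c(2,3)], of _ 1],
        simp, (intro append_cols_carrier; simp),
        subst append_cols_mult_vec[OF _ _ c(2,3), of _ 1])
      (use c in auto)
  moreover have "(- mat_of_row (unit_vec l (l - 1)) *\<^sub>v z3) $ 0 = - z3 $ (l - 1)"
  proof -
    have "(- mat_of_row (unit_vec l (l - 1)) *\<^sub>v z3) $ 0 = - (unit_vec l (l - 1)) \<bullet> z3"
      by (simp add: row_uminus)
    also have "\<dots> = - z3 $ (l - 1)"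
      using c l by simp
    finally show ?thesis .
  qed
  ultimately have "(C * Y * B) $$ (0, 0) = u \<bullet> (E *\<^sub>v v) / (u \<bullet> (A *\<^sub>v v))"
    using z3 by simp
  then have "mat 1 1 (\<lambda>_. u \<bullet> (E *\<^sub>v v) / (u \<bullet> (A *\<^sub>v v))) = C * Y * B"
    using Cc Bc by (intro eq_matI) auto
  moreover have "inverts_mat \<Phi> Y" "inverts_mat Y \<Phi>"
    using Y Phi unfolding inverts_mat_def by auto
  ultimately show ?thesis using Y(1) by blast
qed

section \<open>Kronecker products\<close>

text \<open>Each t below n * p is x * p + y for exactly one pair, and the induction peels off the
  last block of p consecutive indices. In \<open>kron_mult\<close> this splits the inner summation
  index.\<close>

lemma sum_div_mod:
  fixes f :: "nat \<Rightarrow> nat \<Rightarrow> 'a :: comm_monoid_add"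
  shows "(\<Sum>t<n * p. f (t div p) (t mod p)) = (\<Sum>x<n. \<Sum>y<p. f x y)"
proof (induction n)
  case (Suc n)
  have "(\<Sum>t<Suc n * p. f (t div p) (t mod p))
      = (\<Sum>t<n * p. f (t div p) (t mod p)) + (\<Sum>t=n * p..<n * p + p. f (t div p) (t mod p))"
    by (simp add: sum.atLeastLessThan_concat lessThan_atLeast0 add.commute)
  also have "(\<Sum>t=n * p..<n * p + p. f (t div p) (t mod p)) = (\<Sum>y<p. f n y)"
    using sum.shift_bounds_nat_ivl[of "\<lambda>t. f (t div p) (t mod p)" 0 "n * p" p]
    by (auto simp: lessThan_atLeast0 add.commute intro!: sum.cong)
  finally show ?case using Suc by simp
qed simp

lemma kron_carrier [simp, intro]:
  "A \<in> carrier_mat a b \<Longrightarrow> B \<in> carrier_mat c d \<Longrightarrow> kron A B \<in> carrier_mat (a * c) (b * d)"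
  unfolding kron_def by auto

lemma div_mod_less_mult:
  fixes i a b :: nat
  assumes "i < a * b"
  shows "i div b < a" "i mod b < b"
  using assms by (auto simp: less_mult_imp_div_less intro!: mod_less_divisor gr0I)

text \<open>The decomposition a * b - 1 = (a - 1) * b + (b - 1) places the last row of a Kronecker
  product in the last rows of both factors.\<close>

lemma last_index_div_mod:
  fixes a b :: nat
  assumes "0 < a" "0 < b"
  shows "(a * b - 1) div b = a - 1" "(a * b - 1) mod b = b - 1"
proof -
  have "a * b - 1 = (b - 1) + b * (a - 1)"
    using assms by (cases a) (auto simp: mult.commute)
  moreover have "b \<noteq> 0" "b - 1 < b" using assms by simp_all
  ultimately show "(a * b - 1) div b = a - 1" "(a * b - 1) mod b = b - 1"
    by (simp_all only: div_mult_self2 mod_mult_self2 not_False_eq_True div_less mod_less add_0_right)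
qed

lemma index_kron:
  assumes "A \<in> carrier_mat a b" "B \<in> carrier_mat c d" "i < a * c" "j < b * d"
  shows "kron A B $$ (i, j) = A $$ (i div c, j div d) * B $$ (i mod c, j mod d)"
  using assms unfolding kron_def by auto

text \<open>Mixed-product property: once the inner index is split by quotient and remainder, the
  summand separates and the double sum factors. Commutativity is needed to regroup the four
  entries.\<close>

lemma kron_mult:
  fixes A B C D :: "'a :: comm_semiring_1 mat"
  assumes A: "A \<in> carrier_mat a n" and B: "B \<in> carrier_mat b p"
    and C: "C \<in> carrier_mat n c" and D: "D \<in> carrier_mat p d"
  shows "kron A B * kron C D = kron (A * C) (B * D)"
proof (rule eq_matI)
  fix i j assume "i < dim_row (kron (A * C) (B * D))" "j < dim_col (kron (A * C) (B * D))"
  then have i: "i < a * b" and j: "j < c * d"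
    using A B C D by (auto simp: kron_def)
  note ij = div_mod_less_mult[OF i] div_mod_less_mult[OF j]
  have "(kron A B * kron C D) $$ (i, j) = (\<Sum>t<n * p. kron A B $$ (i, t) * kron C D $$ (t, j))"
    using i j kron_carrier[OF A B] kron_carrier[OF C D]
    by (auto simp: scalar_prod_def lessThan_atLeast0 intro!: sum.cong)
  also have "\<dots> = (\<Sum>t<n * p. (A $$ (i div b, t div p) * B $$ (i mod b, t mod p))
      * (C $$ (t div p, j div d) * D $$ (t mod p, j mod d)))"
    using i j by (intro sum.cong refl) (simp add: index_kron[OF A B] index_kron[OF C D])
  also have "\<dots> = (\<Sum>x<n. \<Sum>y<p. (A $$ (i div b, x) * B $$ (i mod b, y))
      * (C $$ (x, j div d) * D $$ (y, j mod d)))"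
    by (rule sum_div_mod)
  also have "\<dots> = (\<Sum>x<n. A $$ (i div b, x) * C $$ (x, j div d))
      * (\<Sum>y<p. B $$ (i mod b, y) * D $$ (y, j mod d))"
    by (simp add: sum_product mult_ac)
  also have "\<dots> = (A * C) $$ (i div b, j div d) * (B * D) $$ (i mod b, j mod d)"
    using ij A B C D by (simp add: scalar_prod_def lessThan_atLeast0)
  also have "\<dots> = kron (A * C) (B * D) $$ (i, j)"
    using i j A B C D by (subst index_kron[of _ a c _ b d]) auto
  finally show "(kron A B * kron C D) $$ (i, j) = kron (A * C) (B * D) $$ (i, j)" .
qed (use A B C D in \<open>auto simp: kron_def\<close>)

lemma kron_one: "kron (1\<^sub>m a) (1\<^sub>m b) = (1\<^sub>m (a * b) :: 'a :: semiring_1 mat)"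
proof (rule eq_matI)
  fix i j assume "i < dim_row (1\<^sub>m (a * b) :: 'a mat)" "j < dim_col (1\<^sub>m (a * b) :: 'a mat)"
  then have i: "i < a * b" and j: "j < a * b" by auto
  have "i div b = j div b \<and> i mod b = j mod b \<longleftrightarrow> i = j"
    by (metis div_mult_mod_eq)
  then show "kron (1\<^sub>m a) (1\<^sub>m b) $$ (i, j) = (1\<^sub>m (a * b) :: 'a mat) $$ (i, j)"
    using div_mod_less_mult[OF i] div_mod_less_mult[OF j] i j
    by (subst index_kron[of _ a a _ b b]) auto
qed (auto simp: kron_def)

text \<open>The last unit vector as a one-column matrix, so that the mixed-product rule for matrices
  also covers products with vectors.\<close>

definition last_column :: "nat \<Rightarrow> 'a :: semiring_1 mat" where
  "last_column n = mat n 1 (\<lambda>(i, _). if i = n - 1 then 1 else 0)"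

lemma last_column_carrier [simp]: "last_column n \<in> carrier_mat n 1"
  unfolding last_column_def by simp

lemma kron_last_column:
  assumes "0 < a" "0 < b"
  shows "kron (s \<cdot>\<^sub>m last_column a) (t \<cdot>\<^sub>m last_column b) = (s * t :: 'a :: comm_semiring_1) \<cdot>\<^sub>m last_column (a * b)"
proof (rule eq_matI)
  fix i j assume "i < dim_row ((s * t) \<cdot>\<^sub>m last_column (a * b))" "j < dim_col ((s * t) \<cdot>\<^sub>m last_column (a * b))"
  then have i: "i < a * b" and j: "j = 0"
    by (auto simp: last_column_def)
  note ij = div_mod_less_mult[OF i]
  have "i div b = a - 1 \<and> i mod b = b - 1 \<longleftrightarrow> i = a * b - 1"
  proof
    assume "i div b = a - 1 \<and> i mod b = b - 1"
    then have "i = (a - 1) * b + (b - 1)"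
      by (metis div_mult_mod_eq)
    then show "i = a * b - 1"
      using assms by (cases a) (auto simp: mult.commute)
  next
    assume "i = a * b - 1"
    then show "i div b = a - 1 \<and> i mod b = b - 1"
      using last_index_div_mod[OF assms] by simp
  qed
  then show "kron (s \<cdot>\<^sub>m last_column a) (t \<cdot>\<^sub>m last_column b) $$ (i, j)
      = ((s * t) \<cdot>\<^sub>m last_column (a * b)) $$ (i, j)"
    using i j ij by (subst index_kron[of _ a 1 _ b 1]) (auto simp: last_column_def)
qed (auto simp: kron_def last_column_def)

lemma kron_list_Nil [simp]: "kron_list [] = 1\<^sub>m 1"

  \<comment> \<open>Iterated Kronecker products\<close>
  and kron_list_Cons [simp]: "kron_list (M # Ms) = kron M (kron_list Ms)"
  unfolding kron_list_def by simp_all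

lemma kron_list_carrier:
  assumes "\<And>j. j \<in> set js \<Longrightarrow> f j \<in> carrier_mat (r j) (s j)"
  shows "kron_list (map f js) \<in> carrier_mat (prod_list (map r js)) (prod_list (map s js))"
  using assms by (induction js) auto

lemma kron_list_mult:
  fixes f g :: "'b \<Rightarrow> 'a :: comm_semiring_1 mat"
  assumes "\<And>j. j \<in> set js \<Longrightarrow> f j \<in> carrier_mat (r j) (s j)"
    and "\<And>j. j \<in> set js \<Longrightarrow> g j \<in> carrier_mat (s j) (t j)"
  shows "kron_list (map f js) * kron_list (map g js) = kron_list (map (\<lambda>j. f j * g j) js)"
  using assms
proof (induction js)
  case (Cons j js)
  have "kron (f j) (kron_list (map f js)) * kron (g j) (kron_list (map g js))
      = kron (f j * g j) (kron_list (map f js) * kron_list (map g js))"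
    using Cons.prems kron_list_carrier[of js f r s] kron_list_carrier[of js g s t]
    by (intro kron_mult[of _ "r j" "s j" _ "prod_list (map r js)" "prod_list (map s js)" _ "t j" _
          "prod_list (map t js)"]) auto
  then show ?case using Cons by simp
qed simp

lemma kron_list_one:
  "kron_list (map (\<lambda>j. 1\<^sub>m (r j)) js) = (1\<^sub>m (prod_list (map r js)) :: 'a :: semiring_1 mat)"
  by (induction js) (auto simp: kron_one)

lemma prod_list_map_pos:
  fixes r :: "'b \<Rightarrow> nat"
  assumes "\<And>j. j \<in> set js \<Longrightarrow> 0 < r j"
  shows "0 < prod_list (map r js)"
  using assms by (induction js) auto

lemma kron_list_last_column:
  assumes "\<And>j. j \<in> set js \<Longrightarrow> 0 < r j"
  shows "kron_list (map (\<lambda>j. s j \<cdot>\<^sub>m last_column (r j)) js)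
    = (prod_list (map s js) :: 'a :: comm_semiring_1) \<cdot>\<^sub>m last_column (prod_list (map r js))"
  using assms
proof (induction js)
  case Nil
  show ?case by (rule eq_matI) (auto simp: last_column_def)
next
  case (Cons j js)
  then have "0 < prod_list (map r js)"
    by (intro prod_list_map_pos) auto
  then show ?case using Cons by (simp add: kron_last_column)
qed

lemma (in semiring_hom) map_kron:
  assumes "A \<in> carrier_mat a b" "B \<in> carrier_mat c d"
  shows "map_mat hom (kron A B) = kron (map_mat hom A) (map_mat hom B)"
proof (rule eq_matI)
  fix i j assume "i < dim_row (kron (map_mat hom A) (map_mat hom B))"
    "j < dim_col (kron (map_mat hom A) (map_mat hom B))"
  then have i: "i < a * c" and j: "j < b * d"
    using assms by (auto simp: kron_def)
  note ij = div_mod_less_mult[OF i] div_mod_less_mult[OF j]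
  show "map_mat hom (kron A B) $$ (i, j) = kron (map_mat hom A) (map_mat hom B) $$ (i, j)"
    using i j ij assms by (simp add: kron_def hom_mult)
qed (auto simp: kron_def)

lemma (in semiring_hom) map_kron_list:
  assumes "\<And>j. j \<in> set js \<Longrightarrow> f j \<in> carrier_mat (r j) (s j)"
  shows "map_mat hom (kron_list (map f js)) = kron_list (map (\<lambda>j. map_mat hom (f j)) js)"
  using assms
proof (induction js)
  case Nil
  show ?case by (rule eq_matI) (auto simp: hom_one)
next
  case (Cons j js)
  then show ?case
    using map_kron[of "f j" "r j" "s j" "kron_list (map f js)"] kron_list_carrier[of js f r s]
    by simp
qed

text \<open>No determinant formula for Kronecker products is used: by the mixed-product rule the
  product of the inverses of the factors is a right inverse, so the determinant divides 1.\<close>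

lemma det_kron_list_nonzero:
  fixes f :: "'b \<Rightarrow> 'a :: field mat"
  assumes f: "\<And>j. j \<in> set js \<Longrightarrow> f j \<in> carrier_mat (r j) (r j)"
    and det: "\<And>j. j \<in> set js \<Longrightarrow> det (f j) \<noteq> 0"
  shows "det (kron_list (map f js)) \<noteq> 0"
proof -
  have "\<exists>Y. Y \<in> carrier_mat (r j) (r j) \<and> f j * Y = 1\<^sub>m (r j)" if "j \<in> set js" for j
    using invertible_from_det[OF f[OF that] det[OF that]] by blast
  then obtain g where g: "\<And>j. j \<in> set js \<Longrightarrow> g j \<in> carrier_mat (r j) (r j)"
      "\<And>j. j \<in> set js \<Longrightarrow> f j * g j = 1\<^sub>m (r j)"
    by metis
  have "kron_list (map f js) * kron_list (map g js) = kron_list (map (\<lambda>j. f j * g j) js)"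
    by (rule kron_list_mult[OF f g(1)])
  also have "map (\<lambda>j. f j * g j) js = map (\<lambda>j. 1\<^sub>m (r j)) js"
    using g(2) by simp
  finally have "kron_list (map f js) * kron_list (map g js) = 1\<^sub>m (prod_list (map r js))"
    by (simp add: kron_list_one)
  then have "det (kron_list (map f js)) * det (kron_list (map g js)) = 1"
    using det_mult[OF kron_list_carrier[of js f r r, OF f] kron_list_carrier[of js g r r, OF g(1)]]
    by simp
  then show ?thesis by auto
qed

text \<open>Every entry is a product of entries of the factors, with 1 from the empty product.
  Taking polynomials in given variables for S controls the entries of Gamma and Delta.\<close>

lemma elements_kron_list:
  fixes f :: "'b \<Rightarrow> 'a :: semiring_1 mat"
  assumes S: "1 \<in> S" "\<And>x y. x \<in> S \<Longrightarrow> y \<in> S \<Longrightarrow> x * y \<in> S"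
    and f: "\<And>j. j \<in> set js \<Longrightarrow> f j \<in> carrier_mat (r j) (s j)" "\<And>j. j \<in> set js \<Longrightarrow> elements_mat (f j) \<subseteq> S"
  shows "elements_mat (kron_list (map f js)) \<subseteq> S"
  using f
proof (induction js)
  case Nil
  then show ?case using S by (auto dest!: elements_matD)
next
  case (Cons j js)
  let ?R = "prod_list (map r js)" and ?S = "prod_list (map s js)"
  have K: "kron_list (map f js) \<in> carrier_mat ?R ?S" and F: "f j \<in> carrier_mat (r j) (s j)"
    using Cons.prems by (auto intro: kron_list_carrier)
  show ?case
  proof
    fix x assume "x \<in> elements_mat (kron_list (map f (j # js)))"
    then obtain a b where ab: "a < r j * ?R" "b < s j * ?S" "x = kron (f j) (kron_list (map f js)) $$ (a, b)"
      using kron_carrier[OF F K] by (auto dest!: elements_matD)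
    note * = div_mod_less_mult[OF ab(1)] div_mod_less_mult[OF ab(2)]
    have "f j $$ (a div ?R, b div ?S) \<in> S"
      using Cons.prems(2)[of j] F * by auto
    moreover have "kron_list (map f js) $$ (a mod ?R, b mod ?S) \<in> S"
      using Cons K * by auto
    ultimately show "x \<in> S"
      using S(2) ab index_kron[OF F K] by auto
  qed
qed

text \<open>The last row of the product involves only the last rows of the factors. With constants
  for S this makes the last row of Delta, and hence B, constant, although other entries of Delta are
  not.\<close>

lemma last_row_kron_list:
  fixes f :: "'b \<Rightarrow> 'a :: semiring_1 mat"
  assumes S: "1 \<in> S" "\<And>x y. x \<in> S \<Longrightarrow> y \<in> S \<Longrightarrow> x * y \<in> S"
    and f: "\<And>j. j \<in> set js \<Longrightarrow> f j \<in> carrier_mat (r j) (s j)" "\<And>j. j \<in> set js \<Longrightarrow> 0 < r j"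
      "\<And>j b. j \<in> set js \<Longrightarrow> b < s j \<Longrightarrow> f j $$ (r j - 1, b) \<in> S"
    and b: "b < prod_list (map s js)"
  shows "kron_list (map f js) $$ (prod_list (map r js) - 1, b) \<in> S"
  using f b
proof (induction js arbitrary: b)
  case Nil
  then show ?case using S by simp
next
  case (Cons j js)
  let ?R = "prod_list (map r js)" and ?S = "prod_list (map s js)"
  have K: "kron_list (map f js) \<in> carrier_mat ?R ?S" and F: "f j \<in> carrier_mat (r j) (s j)"
    using Cons.prems by (auto intro: kron_list_carrier)
  have R: "0 < ?R" "0 < r j"
    using Cons.prems(2) by (auto intro: prod_list_map_pos)
  have b: "b < s j * ?S" using Cons.prems by simp
  have "kron (f j) (kron_list (map f js)) $$ (r j * ?R - 1, b)
      = f j $$ (r j - 1, b div ?S) * kron_list (map f js) $$ (?R - 1, b mod ?S)"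
    using R b last_index_div_mod[OF R(2,1)] by (subst index_kron[OF F K]) simp_all
  moreover have "f j $$ (r j - 1, b div ?S) \<in> S"
    using Cons.prems div_mod_less_mult[OF b] by auto
  moreover have "kron_list (map f js) $$ (?R - 1, b mod ?S) \<in> S"
    using Cons.prems div_mod_less_mult[OF b] by (intro Cons.IH) auto
  ultimately show ?case using S(2) by simp
qed

section \<open>Multi-indices\<close>

text \<open>The list counterpart of \<open>index_kron\<close>: lexicographic position splits into
  quotient and remainder exactly as a Kronecker index does.\<close>

lemma nth_concat_map_map:
  assumes "r < length xs * length ys"
  shows "concat (map (\<lambda>x. map (f x) ys) xs) ! r = f (xs ! (r div length ys)) (ys ! (r mod length ys))"
  using assms
proof (induction xs arbitrary: r)
  case (Cons x xs)
  have ys: "0 < length ys" using Cons.prems by (auto intro!: gr0I)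
  show ?case
  proof (cases "r < length ys")
    case False
    then have "r div length ys = Suc ((r - length ys) div length ys)"
      "r mod length ys = (r - length ys) mod length ys"
      using ys by (simp_all add: le_div_geq le_mod_geq)
    moreover have "r - length ys < length xs * length ys"
      using Cons.prems False by auto
    ultimately show ?thesis
      using Cons.IH False by (simp add: nth_append)
  qed (simp add: nth_append)
qed simp

lemma length_concat_map_map: "length (concat (map (\<lambda>x. map (f x) ys) xs)) = length xs * length ys"
  by (induction xs) auto

lemma multi_indices_Nil [simp]: "multi_indices N [] = [[]]"
  and multi_indices_Cons: "multi_indices N (j # js) =
    concat (map (\<lambda>i. map ((#) i) (multi_indices N js)) [1..<Suc (N j)])"
  unfolding multi_indices_def by simp_all

lemma length_multi_indices: "length (multi_indices N js) = prod_list (map N js)"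
proof (induction js)
  case (Cons j js)
  then show ?case
    unfolding multi_indices_Cons length_concat_map_map by simp
qed simp

lemma distinct_multi_indices: "distinct (multi_indices N js)"
  unfolding multi_indices_def by (intro distinct_product_lists) auto

lemma length_in_multi_indices: "is \<in> set (multi_indices N js) \<Longrightarrow> length is = length js"
  unfolding multi_indices_def by (auto dest: in_set_product_lists_length)

lemma multi_indices_append:
  "multi_indices N (js @ ks) =
    concat (map (\<lambda>is. map (\<lambda>is'. is @ is') (multi_indices N ks)) (multi_indices N js))"
proof (induction js)
  case (Cons j js)
  let ?F = "\<lambda>is. map (\<lambda>is'. is @ is') (multi_indices N ks)"
  \<comment> \<open>Prefixing one further index commutes with appending the trailing multi-indices,
    so the induction acts on the leading part only.\<close>
  have step: "concat (map ?F (map ((#) i) J)) = map ((#) i) (concat (map ?F J))" for i J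
    by (auto simp: map_concat intro!: arg_cong[where f = concat])
  have "concat (map ?F (concat (map (\<lambda>i. map ((#) i) J) I)))
      = concat (map (\<lambda>i. map ((#) i) (concat (map ?F J))) I)" for I J
    by (induction I) (simp_all only: list.map concat.simps map_append concat_append step)
  then show ?case
    by (simp only: append_Cons multi_indices_Cons Cons)
qed (simp add: map_idI)

text \<open>Turns a sum over all multi-indices into a sum over matrix positions. Passing from the
  set to list positions is sound because the list has no repetitions.\<close>

lemma sum_multi_indices_append:
  fixes f :: "nat list \<Rightarrow> 'a :: comm_monoid_add"
  shows "(\<Sum>is \<in> set (multi_indices N (js @ ks)). f is) =
    (\<Sum>r<prod_list (map N js). \<Sum>q<prod_list (map N ks).
      f (multi_indices N js ! r @ multi_indices N ks ! q))"
proof -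
  have "(\<Sum>is \<in> set (multi_indices N (js @ ks)). f is) = sum_list (map f (multi_indices N (js @ ks)))"
    by (simp add: sum_list_distinct_conv_sum_set distinct_multi_indices)
  also have "\<dots> = (\<Sum>is\<leftarrow>multi_indices N js. \<Sum>is'\<leftarrow>multi_indices N ks. f (is @ is'))"
  proof -
    have "sum_list (map f (concat (map (\<lambda>a. map (\<lambda>b. a @ b) ys) xs)))
        = (\<Sum>a\<leftarrow>xs. \<Sum>b\<leftarrow>ys. f (a @ b))" for xs ys
      by (induction xs) (auto simp: comp_def)
    then show ?thesis unfolding multi_indices_append .
  qed
  finally show ?thesis
    by (simp add: sum_list_sum_nth length_multi_indices lessThan_atLeast0)
qed

text \<open>This ties the two orderings together: multi-index r labels row r of the Kronecker
  product. The \<open>Suc\<close> converts row numbers from 0 into node numbers from 1.\<close>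

lemma kron_list_columns:
  fixes f :: "nat \<Rightarrow> nat \<Rightarrow> 'a :: comm_semiring_1"
  shows "kron_list (map (\<lambda>j. mat (N j) 1 (\<lambda>(i, _). f j (Suc i))) js) =
    mat (prod_list (map N js)) 1 (\<lambda>(r, _). prod_list (map2 f js (multi_indices N js ! r)))"
proof (induction js)
  case Nil
  show ?case by (rule eq_matI) auto
next
  case (Cons j js)
  let ?R = "prod_list (map N js)"
  show ?case
    unfolding list.map kron_list_Cons Cons
  proof (rule eq_matI, goal_cases)
    case (1 r c)
    then have r: "r < N j * ?R" and c: "c = 0" by auto
    note * = div_mod_less_mult[OF r]
    have "multi_indices N (j # js) ! r = Suc (r div ?R) # multi_indices N js ! (r mod ?R)"
      using r * unfolding multi_indices_Cons
      by (subst nth_concat_map_map) (auto simp: length_multi_indices simp del: upt_Suc)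
    then show ?case
      using r c *
      by (subst index_kron[of _ "N j" 1 _ ?R 1]) auto
  qed (auto simp: kron_def)
qed

section \<open>Polynomials and the Lagrange matrices\<close>

interpretation to_fract_hom: comm_ring_hom "to_fract :: 'a :: idom \<Rightarrow> 'a fract"
  by unfold_locales auto

lemma const_0 [simp]: "const 0 = 0"
  and const_1 [simp]: "const 1 = 1"
  and const_minus: "const (- a) = - const a"
  and const_mult: "const (a * b) = const a * const b"
  by (simp_all add: const_def single_uminus mult_single)

lemma const_in_polys_in [simp]: "const a \<in> polys_in V"
  by (auto simp: polys_in_def const_def)

lemma zero_in_polys_in [simp]: "0 \<in> polys_in V"
  by (simp add: polys_in_def)

lemma uminus_in_polys_in: "p \<in> polys_in V \<Longrightarrow> - p \<in> polys_in V"
  by (simp add: polys_in_def)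

lemma mult_in_polys_in:
  assumes "p \<in> polys_in V" "p' \<in> polys_in V"
  shows "p * p' \<in> polys_in V"
proof -
  have "Poly_Mapping.keys e \<subseteq> V" if "e \<in> Poly_Mapping.keys (p * p')" for e
  proof -
    obtain a b where "e = a + b" "a \<in> Poly_Mapping.keys p" "b \<in> Poly_Mapping.keys p'"
      using \<open>e \<in> _\<close> keys_mult[of p p'] by blast
    then show ?thesis
      using assms Poly_Mapping.keys_add[of a b] unfolding polys_in_def by blast
  qed
  then show ?thesis unfolding polys_in_def by blast
qed

lemma xdiff_in_polys_in: "j \<in> V \<Longrightarrow> xdiff lam j i \<in> polys_in V"
  using keys_diff[of "svar j" "const (lam j i)"]
  by (fastforce simp: polys_in_def xdiff_def svar_def const_def split: if_splits)

lemma xdiff_nonzero: "xdiff lam j i \<noteq> 0"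
proof -
  \<comment> \<open>The monomial of s_j differs from the constant monomial, so subtracting the node
    leaves its coefficient 1 intact.\<close>
  have "Poly_Mapping.single j 1 \<noteq> (0 :: nat \<Rightarrow>\<^sub>0 nat)"
    by (metis lookup_single_eq lookup_zero zero_neq_one)
  then have "Poly_Mapping.lookup (xdiff lam j i) (Poly_Mapping.single j 1) = 1"
    by (simp add: xdiff_def svar_def const_def lookup_minus lookup_single)
  then show ?thesis by auto
qed

section \<open>Lagrange matrices and their action on reciprocals of the differences\<close>

lemma lagrange_mat_carrier [simp]: "lagrange_mat N lam q j \<in> carrier_mat (N j) (N j)"
  unfolding lagrange_mat_def by simp

lemma elements_lagrange_mat:
  assumes "j \<in> V"
  shows "elements_mat (lagrange_mat N lam q j) \<subseteq> polys_in V"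
  using xdiff_in_polys_in[OF assms]
  by (auto simp: lagrange_mat_def uminus_in_polys_in dest!: elements_matD)

lemma elements_kron_list_lagrange_mat:
  assumes "set js \<subseteq> V"
  shows "elements_mat (kron_list (map (lagrange_mat N lam q) js)) \<subseteq> polys_in V"
proof (rule elements_kron_list[of _ _ _ N N])
  show "1 \<in> polys_in V"
    using const_in_polys_in[of 1] by simp
  show "elements_mat (lagrange_mat N lam q j) \<subseteq> polys_in V" if "j \<in> set js" for j
    using assms that by (intro elements_lagrange_mat) blast
qed (simp_all add: mult_in_polys_in)

text \<open>The vector v for the variables 1 to k and u for k + 1 to n. Written through
  multi-indices instead of \<open>kron_list\<close>, its entries are literally the factors of the
  terms of a barycentric sum.\<close>

definition inverse_differences ::
  "(nat \<Rightarrow> nat) \<Rightarrow> (nat \<Rightarrow> nat \<Rightarrow> complex) \<Rightarrow> nat list \<Rightarrow> ratfun vec" where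
  "inverse_differences N lam js = vec (prod_list (map N js)) (\<lambda>r.
     prod_list (map2 (\<lambda>j i. 1 / to_fract (xdiff lam j i)) js (multi_indices N js ! r)))"

lemma inverse_differences_carrier [simp]:
  "inverse_differences N lam js \<in> carrier_vec (prod_list (map N js))"
  unfolding inverse_differences_def by simp

lemma lagrange_mat_mult_inverse_differences:
  assumes N: "1 \<le> N j" and det: "det (lagrange_mat N lam q j) = 1"
  obtains g where "g \<noteq> 0"
    "map_mat to_fract (lagrange_mat N lam q j) *
      mat (N j) 1 (\<lambda>(i, _). 1 / to_fract (xdiff lam j (Suc i))) = g \<cdot>\<^sub>m last_column (N j)"
proof -
  let ?M = "map_mat to_fract (lagrange_mat N lam q j)"
  let ?x = "\<lambda>i. to_fract (xdiff lam j (Suc i))"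
  let ?v = "mat (N j) 1 (\<lambda>(i, _). 1 / ?x i)"
  \<comment> \<open>The last row of the Lagrange matrix applied to the reciprocals.\<close>
  define g where "g = (\<Sum>i<N j. to_fract (const (q j (Suc i))) / ?x i)"
  have x: "?x i \<noteq> 0" for i
    using xdiff_nonzero by simp
  have M: "?M \<in> carrier_mat (N j) (N j)" and dM: "det ?M \<noteq> 0"
    using det by simp_all
  have eq: "?M * ?v = g \<cdot>\<^sub>m last_column (N j)"
  proof (rule eq_matI)
    fix a c assume "a < dim_row (g \<cdot>\<^sub>m last_column (N j))" "c < dim_col (g \<cdot>\<^sub>m last_column (N j))"
    then have a: "a < N j" and c: "c = 0" by (auto simp: last_column_def)
    have sum: "(?M * ?v) $$ (a, c) = (\<Sum>b<N j. ?M $$ (a, b) * (1 / ?x b))"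
      using a c M by (simp add: scalar_prod_def lessThan_atLeast0 lagrange_mat_def)
    show "(?M * ?v) $$ (a, c) = (g \<cdot>\<^sub>m last_column (N j)) $$ (a, c)"
    proof (cases "a = N j - 1")
      case True
      then show ?thesis
        unfolding sum using a c
        by (auto simp: g_def last_column_def lagrange_mat_def intro!: sum.cong)
    next
      case False
      \<comment> \<open>Each difference cancels against its reciprocal, so row a contributes 1 at
        column 0 and -1 at column a + 1, and nothing else.\<close>
      have "?M $$ (a, b) * (1 / ?x b) = (if b = 0 then 1 else 0) - (if b = Suc a then 1 else 0)"
        if "b < N j" for b
        using that a False by (auto simp: lagrange_mat_def xdiff_nonzero)
      then have "(\<Sum>b<N j. ?M $$ (a, b) * (1 / ?x b))
          = (\<Sum>b<N j. (if b = 0 then 1 else 0) - (if b = Suc a then 1 else 0))"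
        by (intro sum.cong) auto
      also have "\<dots> = 0"
        using a False by (simp add: sum_subtractf)
      finally show ?thesis
        unfolding sum using a c False by (simp add: last_column_def)
    qed
  qed (auto simp: last_column_def lagrange_mat_def)
  have "g \<noteq> 0"
  proof
    \<comment> \<open>The column of reciprocals would lie in the kernel of an injective matrix, but
      its first entry is nonzero.\<close>
    assume "g = 0"
    have "?M *\<^sub>v col ?v 0 = col (?M * ?v) 0"
      using M by (subst col_mult2[of _ "N j" "N j" _ 1]) auto
    also have "\<dots> = 0\<^sub>v (N j)"
      unfolding eq \<open>g = 0\<close> by (auto simp: last_column_def)
    finally have "col ?v 0 = 0\<^sub>v (N j)"
      by (rule mat_mult_vec_inj[OF M dM, rotated]) simp
    then have "col ?v 0 $ 0 = 0"
      using N by simp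
    then show False
      using N x[of 0] by simp
  qed
  then show ?thesis using that eq by blast
qed

lemma kron_list_lagrange_mat:
  fixes N lam q js
  defines "G \<equiv> map_mat to_fract (kron_list (map (lagrange_mat N lam q) js))"
    and "P \<equiv> prod_list (map N js)"
  assumes N: "\<And>j. j \<in> set js \<Longrightarrow> 1 \<le> N j"
    and det: "\<And>j. j \<in> set js \<Longrightarrow> det (lagrange_mat N lam q j) = 1"
  shows "G \<in> carrier_mat P P" "det G \<noteq> 0"
    "\<exists>g. g \<noteq> 0 \<and> G *\<^sub>v inverse_differences N lam js = g \<cdot>\<^sub>v unit_vec P (P - 1)"
proof -
  let ?M = "\<lambda>j. map_mat to_fract (lagrange_mat N lam q j)"
  let ?v = "\<lambda>j. mat (N j) 1 (\<lambda>(i, _). 1 / to_fract (xdiff lam j (Suc i)))"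
  have G: "G = kron_list (map ?M js)"
    unfolding G_def by (rule to_fract_hom.map_kron_list[of _ _ N N]) simp
  show Gc: "G \<in> carrier_mat P P"
    unfolding G P_def by (rule kron_list_carrier) simp
  show "det G \<noteq> 0"
    unfolding G by (rule det_kron_list_nonzero[of _ _ N]) (simp_all add: det)
  have "\<forall>j\<in>set js. \<exists>g. g \<noteq> 0 \<and> ?M j * ?v j = g \<cdot>\<^sub>m last_column (N j)"
  proof
    fix j assume "j \<in> set js"
    from lagrange_mat_mult_inverse_differences[OF N[OF this] det[OF this]]
    show "\<exists>g. g \<noteq> 0 \<and> ?M j * ?v j = g \<cdot>\<^sub>m last_column (N j)"
      by blast
  qed
  \<comment> \<open>The scalar depends on the variable; a choice function allows the product of all
    of them to be formed, nonzero since there are no zero divisors.\<close>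
  from bchoice[OF this] obtain g where g: "\<And>j. j \<in> set js \<Longrightarrow> g j \<noteq> 0"
      "\<And>j. j \<in> set js \<Longrightarrow> ?M j * ?v j = g j \<cdot>\<^sub>m last_column (N j)"
    by blast
  have v: "kron_list (map ?v js) \<in> carrier_mat P 1"
    using kron_list_columns[of N "\<lambda>j i. 1 / to_fract (xdiff lam j i)" js] unfolding P_def by simp
  have "G * kron_list (map ?v js) = kron_list (map (\<lambda>j. ?M j * ?v j) js)"
    unfolding G by (rule kron_list_mult[of _ _ N N _ "\<lambda>_. 1"]) auto
  also have "\<dots> = kron_list (map (\<lambda>j. g j \<cdot>\<^sub>m last_column (N j)) js)"
    by (intro arg_cong[of _ _ kron_list] map_cong refl g(2))
  also have "\<dots> = prod_list (map g js) \<cdot>\<^sub>m last_column P"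
    unfolding P_def using N by (intro kron_list_last_column) force
  finally have Gv: "G * kron_list (map ?v js) = prod_list (map g js) \<cdot>\<^sub>m last_column P" .
  have P: "0 < P"
    unfolding P_def using N by (intro prod_list_map_pos) force
  have "inverse_differences N lam js = col (kron_list (map ?v js)) 0"
    unfolding inverse_differences_def kron_list_columns[of N "\<lambda>j i. 1 / to_fract (xdiff lam j i)"]
    by (intro eq_vecI) auto
  then have "G *\<^sub>v inverse_differences N lam js = col (G * kron_list (map ?v js)) 0"
    using col_mult2[OF Gc v, of 0] by simp
  also have "\<dots> = prod_list (map g js) \<cdot>\<^sub>v unit_vec P (P - 1)"
    unfolding Gv using P by (intro eq_vecI) (auto simp: last_column_def unit_vec_def)
  finally have "G *\<^sub>v inverse_differences N lam js = prod_list (map g js) \<cdot>\<^sub>v unit_vec P (P - 1)" .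
  moreover have "prod_list (map g js) \<noteq> 0"
    using g(1) by (auto simp: prod_list_zero_iff)
  ultimately show "\<exists>g. g \<noteq> 0 \<and> G *\<^sub>v inverse_differences N lam js = g \<cdot>\<^sub>v unit_vec P (P - 1)"
    by blast
qed

section \<open>Barycentric sums as bilinear forms\<close>

lemma prod_list_map_upt: "prod_list (map f [a..<Suc b]) = (\<Prod>j = a..b. f j)"
  by (simp add: prod.distinct_set_conv_list[symmetric] atLeastLessThanSuc_atLeastAtMost del: upt_Suc)

lemma prod_nth_eq_prod_list:
  assumes "length is = n"
  shows "(\<Prod>j = 1..n. f j (is ! (j - 1))) = prod_list (map2 f [1..<Suc n] is)"
proof -
  have "map2 f [1..<Suc n] is = map (\<lambda>j. f j (is ! (j - 1))) [1..<Suc n]"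
    using assms by (intro nth_equalityI) (auto simp del: upt_Suc)
  then show ?thesis
    by (simp only: prod_list_map_upt)
qed

text \<open>Separation of variables: the denominator of each term splits at k into an entry of v and
  an entry of u, and its coefficient is the matrix entry at their positions. Keeping a arbitrary
  covers numerator and denominator alike.\<close>

lemma barycentric_sum_eq_scalar_prod:
  assumes "k < n"
  shows "barycentric_sum n N lam a =
    inverse_differences N lam [Suc k..<Suc n] \<bullet>
      (map_mat to_fract (map_mat const (coeff_mat n k N a)) *\<^sub>v inverse_differences N lam [1..<Suc k])"
proof -
  let ?js = "[1..<Suc k]" and ?ks = "[Suc k..<Suc n]"
  let ?P = "prod_list (map N ?js)" and ?Q = "prod_list (map N ?ks)"
  let ?f = "\<lambda>j i. 1 / to_fract (xdiff lam j i)"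
  let ?J = "\<lambda>r. multi_indices N ?js ! r" and ?I = "\<lambda>r. multi_indices N ?ks ! r"
  have upt: "[1..<Suc n] = ?js @ ?ks"
    using assms upt_add_eq_append[of 1 "Suc k" "n - k"] by simp
  have dims: "coeff_mat n k N a \<in> carrier_mat ?Q ?P"
    unfolding coeff_mat_def prod_list_map_upt by simp
  have entry: "coeff_mat n k N a $$ (s, r) = a (?J r @ ?I s)" if "r < ?P" "s < ?Q" for r s
    using that unfolding coeff_mat_def prod_list_map_upt by simp
  have term_eq: "to_fract (const (a (?J r @ ?I s))) /
        (\<Prod>j = 1..n. to_fract (xdiff lam j ((?J r @ ?I s) ! (j - 1))))
      = inverse_differences N lam ?ks $ s *
        (to_fract (const (coeff_mat n k N a $$ (s, r))) * inverse_differences N lam ?js $ r)"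
    if r: "r < ?P" and s: "s < ?Q" for r s
  proof -
    have J: "length (?J r) = length ?js" and I: "length (?I s) = length ?ks"
      using r s by (intro length_in_multi_indices[OF nth_mem]; simp only: length_multi_indices)+
    then have "length (?J r @ ?I s) = n"
      using assms by (simp del: upt_Suc)
    then have "(\<Prod>j = 1..n. ?f j ((?J r @ ?I s) ! (j - 1)))
        = prod_list (map2 ?f [1..<Suc n] (?J r @ ?I s))"
      by (rule prod_nth_eq_prod_list)
    also have "\<dots> = prod_list (map2 ?f ?js (?J r)) * prod_list (map2 ?f ?ks (?I s))"
      unfolding upt zip_append[OF J[symmetric]] by simp
    finally have "1 / (\<Prod>j = 1..n. to_fract (xdiff lam j ((?J r @ ?I s) ! (j - 1))))
        = prod_list (map2 ?f ?js (?J r)) * prod_list (map2 ?f ?ks (?I s))"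
      by (simp add: prod_dividef)
    then show ?thesis
      using r s unfolding entry[OF r s] inverse_differences_def
      by (simp add: divide_inverse mult_ac del: upt_Suc)
  qed
  have "barycentric_sum n N lam a = (\<Sum>r<?P. \<Sum>s<?Q. inverse_differences N lam ?ks $ s *
        (to_fract (const (coeff_mat n k N a $$ (s, r))) * inverse_differences N lam ?js $ r))"
    unfolding barycentric_sum_def upt sum_multi_indices_append
    by (intro sum.cong refl) (use term_eq in blast)
  also have "\<dots> = (\<Sum>s<?Q. inverse_differences N lam ?ks $ s * (\<Sum>r<?P.
        to_fract (const (coeff_mat n k N a $$ (s, r))) * inverse_differences N lam ?js $ r))"
    \<comment> \<open>Splitting the multi-index puts the column index outside, whereas the
      matrix-vector product sums over columns inside.\<close>
    by (subst sum.swap) (simp add: sum_distrib_left del: upt_Suc)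
  also have "\<dots> = inverse_differences N lam ?ks \<bullet>
      (map_mat to_fract (map_mat const (coeff_mat n k N a)) *\<^sub>v inverse_differences N lam ?js)"
  proof -
    have "(map_mat to_fract (map_mat const (coeff_mat n k N a)) *\<^sub>v inverse_differences N lam ?js) $ s
        = (\<Sum>r<?P. to_fract (const (coeff_mat n k N a $$ (s, r))) * inverse_differences N lam ?js $ r)"
      if "s < ?Q" for s
      using that dims
      by (auto simp: scalar_prod_def lessThan_atLeast0 inverse_differences_def simp del: upt_Suc
          intro!: sum.cong)
    then show ?thesis
      using dims by (auto simp: scalar_prod_def lessThan_atLeast0 simp del: upt_Suc intro!: sum.cong)
  qed
  finally show ?thesis .
qed

text \<open>Preimages are chosen entry by entry; this reduces the constancy of B and C to a
  statement about single entries.\<close>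

lemma mem_map_mat_image:
  assumes A: "A \<in> carrier_mat r c" and "elements_mat A \<subseteq> range f"
  shows "A \<in> map_mat f ` carrier_mat r c"
proof
  show "A = map_mat f (map_mat (inv_into UNIV f) A)"
    using assms by (intro eq_matI) (auto simp: f_inv_into_f elements_matI subset_iff)
  show "map_mat (inv_into UNIV f) A \<in> carrier_mat r c" using A by simp
qed

theorem theorem2p1:
  fixes n k \<kappa> l m :: nat
    and N :: "nat \<Rightarrow> nat"
    and lam q :: "nat \<Rightarrow> nat \<Rightarrow> complex"
    and c w :: "nat list \<Rightarrow> complex"
    and H :: ratfun
    and \<Gamma> \<Delta> \<Phi> B C :: "mpoly mat"
    and AA BB :: "complex mat"
  assumes k: "0 < k" "k < n"
    and N: "\<And>j. j \<in> {1..n} \<Longrightarrow> 1 \<le> N j"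
    and nodes: "\<And>j. j \<in> {1..n} \<Longrightarrow> inj_on (lam j) {1..N j}"
    and q: "\<And>j. j \<in> {1..n} \<Longrightarrow> det (lagrange_mat N lam q j) = 1"
    and denominator: "barycentric_sum n N lam c \<noteq> 0"
    and H: "H = barycentric_sum n N lam (\<lambda>js. c js * w js) / barycentric_sum n N lam c"
    and \<kappa>: "\<kappa> = (\<Prod>j = 1..k. N j)"
    and l: "l = (\<Prod>j = k+1..n. N j)"
    and m: "m = 2 * l + \<kappa> - 1"
    and \<Gamma>: "\<Gamma> = kron_list (map (lagrange_mat N lam q) [1..<Suc k])"
    and \<Delta>: "\<Delta> = kron_list (map (lagrange_mat N lam q) [Suc k..<Suc n])"
    and AA: "AA = coeff_mat n k N c"
    and BB: "BB = coeff_mat n k N (\<lambda>js. c js * w js)"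
    and \<Phi>: "\<Phi> =
        (rows_of \<Gamma> 1 (\<kappa> - 1) @\<^sub>c 0\<^sub>m (\<kappa> - 1) (l - 1) @\<^sub>c 0\<^sub>m (\<kappa> - 1) l)
        @\<^sub>r (map_mat const AA @\<^sub>c (rows_of \<Delta> 1 (l - 1))\<^sup>T @\<^sub>c 0\<^sub>m l l)
        @\<^sub>r (map_mat const BB @\<^sub>c 0\<^sub>m l (l - 1) @\<^sub>c \<Delta>\<^sup>T)"
    and B: "B = 0\<^sub>m (\<kappa> - 1) 1 @\<^sub>r (rows_of \<Delta> l l)\<^sup>T @\<^sub>r 0\<^sub>m l 1"
    and C: "C = 0\<^sub>m 1 \<kappa> @\<^sub>c 0\<^sub>m 1 (l - 1) @\<^sub>c (- mat_of_row (unit_vec l (l - 1)))"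
  shows "is_realization n m C \<Phi> B H"
proof -
  let ?js = "[1..<Suc k]" and ?ks = "[Suc k..<Suc n]"
  let ?T = "map_mat (to_fract :: mpoly \<Rightarrow> ratfun)"
  let ?v = "inverse_differences N lam ?js" and ?u = "inverse_differences N lam ?ks"
  have P: "prod_list (map N ?js) = \<kappa>" and Q: "prod_list (map N ?ks) = l"
    unfolding \<kappa> l prod_list_map_upt by simp_all
  have js: "j \<in> {1..n}" if "j \<in> set ?js" for j
    using that k by auto
  have ks: "j \<in> {1..n}" if "j \<in> set ?ks" for j
    using that k by auto
  have \<kappa>0: "0 < \<kappa>"
    unfolding \<kappa> using N k by (intro prod_pos) (auto simp: Suc_le_eq)
  have l0: "0 < l"
    unfolding l using N by (intro prod_pos) (auto simp: Suc_le_eq)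
  have \<Gamma>c: "\<Gamma> \<in> carrier_mat \<kappa> \<kappa>" and \<Delta>c: "\<Delta> \<in> carrier_mat l l"
    unfolding \<Gamma> \<Delta> P[symmetric] Q[symmetric] by (rule kron_list_carrier; simp)+
  have Ac: "map_mat const AA \<in> carrier_mat l \<kappa>" and Ec: "map_mat const BB \<in> carrier_mat l \<kappa>"
    unfolding AA BB coeff_mat_def \<kappa> l by simp_all
  have G: "?T \<Gamma> \<in> carrier_mat \<kappa> \<kappa>" "det (?T \<Gamma>) \<noteq> 0"
      "\<exists>g. g \<noteq> 0 \<and> ?T \<Gamma> *\<^sub>v ?v = g \<cdot>\<^sub>v unit_vec \<kappa> (\<kappa> - 1)"
    unfolding \<Gamma> P[symmetric] by (rule kron_list_lagrange_mat; use N q js in blast)+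
  have D: "?T \<Delta> \<in> carrier_mat l l" "det (?T \<Delta>) \<noteq> 0"
      "\<exists>d. d \<noteq> 0 \<and> ?T \<Delta> *\<^sub>v ?u = d \<cdot>\<^sub>v unit_vec l (l - 1)"
    unfolding \<Delta> Q[symmetric] by (rule kron_list_lagrange_mat; use N q ks in blast)+
  obtain g where g: "?T \<Gamma> *\<^sub>v ?v = g \<cdot>\<^sub>v unit_vec \<kappa> (\<kappa> - 1)" "g \<noteq> 0"
    using G(3) by blast
  obtain d where d: "?T \<Delta> *\<^sub>v ?u = d \<cdot>\<^sub>v unit_vec l (l - 1)" "d \<noteq> 0"
    using D(3) by blast
  have v: "?v \<in> carrier_vec \<kappa>" and u: "?u \<in> carrier_vec l"
    unfolding P[symmetric] Q[symmetric] by simp_all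
  have sums: "barycentric_sum n N lam c = ?u \<bullet> (?T (map_mat const AA) *\<^sub>v ?v)"
      "barycentric_sum n N lam (\<lambda>js. c js * w js) = ?u \<bullet> (?T (map_mat const BB) *\<^sub>v ?v)"
    unfolding AA BB by (rule barycentric_sum_eq_scalar_prod[OF k(2)])+

  have rc: "\<kappa> + (l - 1 + l) = m" "\<kappa> - 1 + (l + l) = m"
    using m l0 \<kappa>0 by auto
  have R: "rows_of \<Gamma> 1 (\<kappa> - 1) \<in> carrier_mat (\<kappa> - 1) \<kappa>"
    and Pc: "(rows_of \<Delta> 1 (l - 1))\<^sup>T \<in> carrier_mat l (l - 1)"
    and Lc: "(rows_of \<Delta> l l)\<^sup>T \<in> carrier_mat l 1" and DT: "\<Delta>\<^sup>T \<in> carrier_mat l l"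
    using \<Gamma>c \<Delta>c by auto
  note zero = zero_carrier_mat
  note r1a = append_cols_carrier[OF zero[of "\<kappa> - 1" "l - 1"] zero[of "\<kappa> - 1" l]]
  note r2a = append_cols_carrier[OF Pc zero[of l l]]
  note r3a = append_cols_carrier[OF zero[of l "l - 1"] DT]
  note r1 = append_cols_carrier[OF R r1a] and r2 = append_cols_carrier[OF Ac r2a]
    and r3 = append_cols_carrier[OF Ec r3a]
  note r23 = carrier_append_rows[OF r2 r3]
  note b1 = zero[of "\<kappa> - 1" 1] and b23 = carrier_append_rows[OF Lc zero[of l 1]]
  have ec: "- mat_of_row (unit_vec l (l - 1)) \<in> carrier_mat 1 l"
    by simp
  note c23 = append_cols_carrier[OF zero[of 1 "l - 1"] ec]
  note c1 = append_cols_carrier[OF zero[of 1 \<kappa>] c23]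
  have \<Phi>c: "\<Phi> \<in> carrier_mat m m"
    using carrier_append_rows[OF r1 r23] unfolding \<Phi> rc .
  have Bc: "B \<in> carrier_mat m 1"
    using carrier_append_rows[OF b1 b23] unfolding B rc .
  have Cc: "C \<in> carrier_mat 1 m"
    using c1 unfolding C rc .

  have zero_map: "?T (0\<^sub>m a b) = 0\<^sub>m a b" for a b
    by (intro eq_matI) auto
  \<comment> \<open>The embedding into the fraction field is pushed through every block, so that the
    shape required by \<open>block_realization\<close> reappears.\<close>
  have T\<Phi>: "?T \<Phi> = (rows_of (?T \<Gamma>) 1 (\<kappa> - 1) @\<^sub>c 0\<^sub>m (\<kappa> - 1) (l - 1) @\<^sub>c 0\<^sub>m (\<kappa> - 1) l)
      @\<^sub>r (?T (map_mat const AA) @\<^sub>c (rows_of (?T \<Delta>) 1 (l - 1))\<^sup>T @\<^sub>c 0\<^sub>m l l)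
      @\<^sub>r (?T (map_mat const BB) @\<^sub>c 0\<^sub>m l (l - 1) @\<^sub>c (?T \<Delta>)\<^sup>T)"
    unfolding \<Phi> map_append_rows[OF r1 r23] map_append_rows[OF r2 r3]
      map_append_cols[OF R r1a] map_append_cols[OF Ac r2a] map_append_cols[OF Ec r3a]
      map_append_cols[OF zero[of "\<kappa> - 1" "l - 1"] zero[of "\<kappa> - 1" l]]
      map_append_cols[OF Pc zero[of l l]] map_append_cols[OF zero[of l "l - 1"] DT]
      zero_map map_mat_transpose[symmetric]
      map_rows_of[OF \<Gamma>c order_refl diff_le_self] map_rows_of[OF \<Delta>c order_refl diff_le_self] ..
  have TB: "?T B = 0\<^sub>m (\<kappa> - 1) 1 @\<^sub>r (rows_of (?T \<Delta>) l l)\<^sup>T @\<^sub>r 0\<^sub>m l 1"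
    using l0 map_rows_of[OF \<Delta>c, of l l "to_fract :: mpoly \<Rightarrow> ratfun"]
    unfolding B map_append_rows[OF b1 b23] map_append_rows[OF Lc zero[of l 1]] zero_map
      map_mat_transpose[symmetric] by simp
  have TC: "?T C = 0\<^sub>m 1 \<kappa> @\<^sub>c 0\<^sub>m 1 (l - 1) @\<^sub>c (- mat_of_row (unit_vec l (l - 1)))"
  proof -
    have "?T (- mat_of_row (unit_vec l (l - 1))) = - mat_of_row (unit_vec l (l - 1))"
      by (intro eq_matI) (auto simp: unit_vec_def mat_of_row_def)
    then show ?thesis
      unfolding C map_append_cols[OF zero[of 1 \<kappa>] c23] map_append_cols[OF zero[of 1 "l - 1"] ec] zero_map
      by simp
  qed
  have "\<exists>\<Psi> \<in> carrier_mat m m. inverts_mat (?T \<Phi>) \<Psi> \<and> inverts_mat \<Psi> (?T \<Phi>) \<and>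
      mat 1 1 (\<lambda>_. H) = ?T C * \<Psi> * ?T B"
    unfolding H sums
  proof (rule block_realization[OF G(1,2) \<kappa>0 D(1,2) l0 _ _ v g u d _ m T\<Phi> TB TC])
    show "?u \<bullet> (?T (map_mat const AA) *\<^sub>v ?v) \<noteq> 0"
      using denominator unfolding sums .
  qed (use Ac Ec in \<open>simp_all only: map_carrier_mat\<close>)

  moreover have "elements_mat \<Phi> \<subseteq> polys_in {1..n}"
  proof -
    have el: "elements_mat \<Gamma> \<subseteq> polys_in {1..n}" "elements_mat \<Delta> \<subseteq> polys_in {1..n}"
      unfolding \<Gamma> \<Delta> by (rule elements_kron_list_lagrange_mat; use js ks in blast)+
    have "elements_mat (rows_of \<Gamma> 1 (\<kappa> - 1)) \<subseteq> polys_in {1..n}"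
      "elements_mat (rows_of \<Delta> 1 (l - 1)) \<subseteq> polys_in {1..n}"
      using el elements_rows_of[OF \<Gamma>c order_refl diff_le_self] elements_rows_of[OF \<Delta>c order_refl diff_le_self]
      by blast+
    moreover have "elements_mat (map_mat const M) \<subseteq> polys_in {1..n}" for M
      by auto
    moreover have "elements_mat (0\<^sub>m a b) \<subseteq> polys_in {1..n}" for a b
      using elements_0_mat[of a b] by auto
    ultimately show ?thesis
      unfolding \<Phi> using el(2)
      by (intro order_trans[OF elements_append_rows[OF r1 r23]] order_trans[OF elements_append_rows[OF r2 r3]]
          order_trans[OF elements_append_cols[OF R r1a]] order_trans[OF elements_append_cols[OF Ac r2a]]
          order_trans[OF elements_append_cols[OF Ec r3a]] order_trans[OF elements_append_cols[OF zero zero]]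
          order_trans[OF elements_append_cols[OF Pc zero]] order_trans[OF elements_append_cols[OF zero DT]]
          Un_least) simp_all
  qed
  moreover have "B \<in> map_mat const ` carrier_mat m 1"
  proof (rule mem_map_mat_image[OF Bc])
    \<comment> \<open>The last rows of the Lagrange matrices hold only the constants q, and products
      of constants are constant.\<close>
    have "\<Delta> $$ (l - 1, b) \<in> range const" if "b < l" for b
      unfolding \<Delta> Q[symmetric]
    proof (rule last_row_kron_list[of _ _ _ N N])
      show "1 \<in> range const" using const_1 by (metis rangeI)
      show "x * y \<in> range const" if "x \<in> range const" "y \<in> range const" for x y
        using that by (auto simp: const_mult[symmetric])
      show "0 < N j" if "j \<in> set ?ks" for j
        using N[OF ks[OF that]] by simp
      show "b < prod_list (map N ?ks)" using that Q by simp
    qed (auto simp: lagrange_mat_def)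
    then have "elements_mat (rows_of \<Delta> l l) \<subseteq> range const"
      using \<Delta>c by (auto simp: rows_of_def dest!: elements_matD)
    moreover have "elements_mat (0\<^sub>m a b) \<subseteq> range const" for a b
      using elements_0_mat[of a b] const_0 by (metis order_trans empty_subsetI insert_subset rangeI)
    ultimately show "elements_mat B \<subseteq> range const"
      unfolding B
      by (intro order_trans[OF elements_append_rows[OF b1 b23]]
          order_trans[OF elements_append_rows[OF Lc zero]] Un_least) simp_all
  qed
  moreover have "C \<in> map_mat const ` carrier_mat 1 m"
  proof (rule mem_map_mat_image[OF Cc])
    have 0: "0 \<in> range const" using const_0 by (metis rangeI)
    have "- 1 \<in> range const" using const_1 const_minus by (metis rangeI)
    then have "elements_mat (- mat_of_row (unit_vec l (l - 1))) \<subseteq> range const"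
      using 0 by (auto simp: unit_vec_def dest!: elements_matD)
    moreover have "elements_mat (0\<^sub>m a b) \<subseteq> range const" for a b
      using elements_0_mat[of a b] 0 by blast
    ultimately show "elements_mat C \<subseteq> range const"
      unfolding C
      by (intro order_trans[OF elements_append_cols[OF zero c23]]
          order_trans[OF elements_append_cols[OF zero ec]] Un_least) simp_all
  qed
  ultimately show ?thesis
    using \<Phi>c unfolding is_realization_def by blast
qed

end
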